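(* Let $R$ be a right SAP ring. Then $R$ is a right Noetherian ring if and only if $R$ has right Krull dimension.
   Context: Rings are associative with identity and modules are unital right modules. A right $R$-module $M$ is absolutely pure if it is a pure submodule of every right $R$-module containing it. $R$ is a right SAP ring if every simple right $R$-module is absolutely pure. Krull dimension is in the sense of Gabriel–Rentschler: $R$ has right Krull dimension if the Krull dimension (deviation of the lattice of submodules) of the right module $R_R$ exists, as an ordinal. Here the deviation of a poset $A$ is defined as follows: $\operatorname{dev}A=-\infty$ if $A$ is trivial (no two distinct comparable elements); $\operatorname{dev} A=0$ if $A$ is nontrivial and satisfies the descending chain condition; and for an ordinal $\alpha>0$, $\operatorname{dev}A=\alpha$ if $\operatorname{dev}A$ is not $<\alpha$ and in every descending chain $a_1\ge a_2\ge\cdots$ of $A$ all but finitely many factors $\{x: a_{i+1}\le x\le a_i\}$ have deviation $<\alpha$. *)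

theory Defs
  imports "HOL-Algebra.Ring"
begin

unbundle cardinal_syntax

section \<open>Right modules\<close>

text \<open>
  The modules of \<open>HOL-Algebra\<close> are left modules over commutative rings. As there, a module
  record extends the ring record, whose multiplicative fields are ignored.
\<close>

record ('a, 'b) rmodule = "'b ring" +
  rsmult :: "'b \<Rightarrow> 'a \<Rightarrow> 'b" (infixl \<open>\<cdot>\<index>\<close> 70)

locale right_module = R?: ring R + M?: abelian_group M
  for R :: "('a, 'm) ring_scheme" (structure) and M :: "('a, 'b) rmodule" (structure) +
  assumes rsmult_closed [simp, intro]:
      "\<lbrakk>x \<in> carrier M; r \<in> carrier R\<rbrakk> \<Longrightarrow> x \<cdot>\<^bsub>M\<^esub> r \<in> carrier M"
    and rsmult_r_distr:
      "\<lbrakk>x \<in> carrier M; r \<in> carrier R; s \<in> carrier R\<rbrakk> \<Longrightarrow>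
        x \<cdot>\<^bsub>M\<^esub> (r \<oplus>\<^bsub>R\<^esub> s) = x \<cdot>\<^bsub>M\<^esub> r \<oplus>\<^bsub>M\<^esub> x \<cdot>\<^bsub>M\<^esub> s"
    and rsmult_l_distr:
      "\<lbrakk>x \<in> carrier M; y \<in> carrier M; r \<in> carrier R\<rbrakk> \<Longrightarrow>
        (x \<oplus>\<^bsub>M\<^esub> y) \<cdot>\<^bsub>M\<^esub> r = x \<cdot>\<^bsub>M\<^esub> r \<oplus>\<^bsub>M\<^esub> y \<cdot>\<^bsub>M\<^esub> r"
    and rsmult_assoc:
      "\<lbrakk>x \<in> carrier M; r \<in> carrier R; s \<in> carrier R\<rbrakk> \<Longrightarrow>
        x \<cdot>\<^bsub>M\<^esub> (r \<otimes>\<^bsub>R\<^esub> s) = (x \<cdot>\<^bsub>M\<^esub> r) \<cdot>\<^bsub>M\<^esub> s"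
    and rsmult_one [simp]: "x \<in> carrier M \<Longrightarrow> x \<cdot>\<^bsub>M\<^esub> \<one>\<^bsub>R\<^esub> = x"

definition regular_rmodule :: "('a, 'm) ring_scheme \<Rightarrow> ('a, 'a) rmodule" where
  "regular_rmodule R =
    \<lparr>carrier = carrier R, mult = mult R, one = one R, zero = zero R, add = add R,
     rsmult = mult R\<rparr>"

lemma right_module_regular:
  assumes "ring R"
  shows "right_module R (regular_rmodule R)"
proof -
  interpret ring R by fact
  have "abelian_group (regular_rmodule R)"
  proof (rule abelian_groupI)
    fix x assume "x \<in> carrier (regular_rmodule R)"
    then show "\<exists>y\<in>carrier (regular_rmodule R). y \<oplus>\<^bsub>regular_rmodule R\<^esub> x = \<zero>\<^bsub>regular_rmodule R\<^esub>"
      by (intro bexI[of _ "\<ominus>\<^bsub>R\<^esub> x"]) (auto simp: regular_rmodule_def l_neg)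
  qed (auto simp: regular_rmodule_def add.m_ac)
  then show ?thesis
    by (intro right_module.intro right_module_axioms.intro assms)
      (auto simp: regular_rmodule_def r_distr l_distr m_assoc)
qed

definition rsubmodule ::
  "('a, 'm) ring_scheme \<Rightarrow> ('a, 'b) rmodule \<Rightarrow> 'b set \<Rightarrow> bool" where
  "rsubmodule R M N \<longleftrightarrow> subgroup N (add_monoid M) \<and>
    (\<forall>x\<in>N. \<forall>r\<in>carrier R. x \<cdot>\<^bsub>M\<^esub> r \<in> N)"

definition rsubmodules ::
  "('a, 'm) ring_scheme \<Rightarrow> ('a, 'b) rmodule \<Rightarrow> 'b set set" where
  "rsubmodules R M = {N. rsubmodule R M N}"

definition rmodule_hom ::
  "('a, 'm) ring_scheme \<Rightarrow> ('a, 'b) rmodule \<Rightarrow> ('a, 'c) rmodule \<Rightarrow> ('b \<Rightarrow> 'c) set" where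
  "rmodule_hom R M N = {f \<in> carrier M \<rightarrow> carrier N.
    (\<forall>x\<in>carrier M. \<forall>y\<in>carrier M. f (x \<oplus>\<^bsub>M\<^esub> y) = f x \<oplus>\<^bsub>N\<^esub> f y) \<and>
    (\<forall>x\<in>carrier M. \<forall>r\<in>carrier R. f (x \<cdot>\<^bsub>M\<^esub> r) = f x \<cdot>\<^bsub>N\<^esub> r)}"

definition simple_rmodule :: "('a, 'm) ring_scheme \<Rightarrow> ('a, 'b) rmodule \<Rightarrow> bool" where
  "simple_rmodule R M \<longleftrightarrow> right_module R M \<and> carrier M \<noteq> {\<zero>\<^bsub>M\<^esub>} \<and>
    (\<forall>N. rsubmodule R M N \<longrightarrow> N = {\<zero>\<^bsub>M\<^esub>} \<or> N = carrier M)"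

definition right_noetherian :: "('a, 'm) ring_scheme \<Rightarrow> bool" where
  "right_noetherian R \<longleftrightarrow>
    (\<forall>I :: nat \<Rightarrow> 'a set. (\<forall>i. rsubmodule R (regular_rmodule R) (I i)) \<and> (\<forall>i. I i \<subseteq> I (Suc i))
      \<longrightarrow> (\<exists>n. \<forall>i\<ge>n. I i = I n))"


section \<open>Purity\<close>

text \<open>
  A submodule \<open>P\<close> of \<open>N\<close> is pure if every finite system of linear equations
  \<open>x\<^sub>0 r\<^sub>i\<^sub>0 + \<dots> + x\<^sub>n\<^sub>-\<^sub>1 r\<^sub>i\<^sub>n\<^sub>-\<^sub>1 = p\<^sub>i\<close> (\<open>i < m\<close>) with \<open>r\<^sub>i\<^sub>j \<in> R\<close> and \<open>p\<^sub>i \<in> P\<close> that is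
  solvable in \<open>N\<close> is solvable in \<open>P\<close> (purity in the sense of Cohn).
\<close>

definition solves ::
  "('a, 'b) rmodule \<Rightarrow> nat \<Rightarrow> nat \<Rightarrow> (nat \<Rightarrow> nat \<Rightarrow> 'a) \<Rightarrow> (nat \<Rightarrow> 'b) \<Rightarrow> (nat \<Rightarrow> 'b) \<Rightarrow> bool" where
  "solves N m n A p x \<longleftrightarrow> (\<forall>i<m. (\<Oplus>\<^bsub>N\<^esub>j\<in>{..<n}. x j \<cdot>\<^bsub>N\<^esub> A i j) = p i)"

definition pure_rsubmodule ::
  "('a, 'm) ring_scheme \<Rightarrow> ('a, 'b) rmodule \<Rightarrow> 'b set \<Rightarrow> bool" where
  "pure_rsubmodule R N P \<longleftrightarrow> rsubmodule R N P \<and>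
    (\<forall>m n A p. (\<forall>i<m. \<forall>j<n. A i j \<in> carrier R) \<and> (\<forall>i<m. p i \<in> P) \<and>
      (\<exists>x. (\<forall>j<n. x j \<in> carrier N) \<and> solves N m n A p x)
      \<longrightarrow> (\<exists>x. (\<forall>j<n. x j \<in> P) \<and> solves N m n A p x))"

text \<open>
  HOL cannot quantify over the modules of all types inside a definition. Extensions of \<open>M\<close>
  are taken as embeddings of \<open>M\<close> into modules \<open>N\<close> with elements in the type
  \<open>'b \<times> (nat \<Rightarrow> 'a)\<close>, which has room for every extension of \<open>M\<close> by finitely many generators;
  simple modules are taken with elements in \<open>'a set\<close>, the type of the residue classes of
  \<open>R / I\<close>. The theorems \<open>absolutely_pure_all_types\<close> and \<open>right_SAP_all_types\<close> below
  show that the two notions so defined cover modules of arbitrary types.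
\<close>

definition absolutely_pure :: "('a, 'm) ring_scheme \<Rightarrow> ('a, 'b) rmodule \<Rightarrow> bool" where
  "absolutely_pure R M \<longleftrightarrow> right_module R M \<and>
    (\<forall>(N :: ('a, 'b \<times> (nat \<Rightarrow> 'a)) rmodule) f.
      right_module R N \<and> f \<in> rmodule_hom R M N \<and> inj_on f (carrier M)
      \<longrightarrow> pure_rsubmodule R N (f ` carrier M))"

definition right_SAP :: "('a, 'm) ring_scheme \<Rightarrow> bool" where
  "right_SAP R \<longleftrightarrow> ring R \<and>
    (\<forall>S :: ('a, 'a set) rmodule. simple_rmodule R S \<longrightarrow> absolutely_pure R S)"


section \<open>Deviation and Krull dimension\<close>

text \<open>
  Posets are subsets of an ordered type with the induced order. Ordinals are represented by
  well-orders, compared by \<open><o\<close> and identified up to \<open>=o\<close>; the empty relation is the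
  ordinal zero.
\<close>

definition trivial_poset :: "'p::order set \<Rightarrow> bool" where
  "trivial_poset A \<longleftrightarrow> (\<forall>x\<in>A. \<forall>y\<in>A. x \<le> y \<longrightarrow> x = y)"

definition descending_chain :: "'p::order set \<Rightarrow> (nat \<Rightarrow> 'p) \<Rightarrow> bool" where
  "descending_chain A a \<longleftrightarrow> (\<forall>i. a i \<in> A) \<and> (\<forall>i. a (Suc i) \<le> a i)"

definition interval_of :: "'p::order set \<Rightarrow> 'p \<Rightarrow> 'p \<Rightarrow> 'p set" where
  "interval_of A l u = {x \<in> A. l \<le> x \<and> x \<le> u}"

text \<open>
  \<open>has_dev A \<alpha>\<close> means \<open>dev A = \<alpha>\<close> for an ordinal \<open>\<alpha>\<close>; the value \<open>-\<infinity>\<close> is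
  \<^const>\<open>trivial_poset\<close>. In the recursive clause, \<open>below B\<close> stands for \<open>dev B < \<alpha>\<close>.
\<close>

function has_dev :: "'p::order set \<Rightarrow> 'i rel \<Rightarrow> bool" where
  "has_dev A \<alpha> \<longleftrightarrow> Well_order \<alpha> \<and>
    (if \<alpha> = {} then
       \<not> trivial_poset A \<and> (\<forall>a. descending_chain A a \<longrightarrow> (\<exists>n. \<forall>i\<ge>n. a i = a n))
     else
       (let below = \<lambda>B. trivial_poset B \<or> (\<exists>\<beta>\<in>{\<beta>. \<beta> <o \<alpha>}. has_dev B \<beta>)
        in \<not> below A \<and>
           (\<forall>a. descending_chain A a \<longrightarrow>
              finite {i. \<not> below (interval_of A (a (Suc i)) (a i))})))"
  by pat_completeness auto
termination
  by (relation "inv_image ordLess snd") (auto simp: wf_ordLess)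

declare has_dev.simps [simp del]

text \<open>
  If a poset with elements in \<open>'p\<close> has an ordinal as its deviation, then this ordinal is
  represented by a well-order on \<open>'p \<times> 'p\<close> (theorem \<open>has_dev_all_types\<close> below). The
  zero module, with deviation \<open>-\<infinity>\<close>, counts as having Krull dimension.
\<close>

definition has_krull_dim :: "('a, 'm) ring_scheme \<Rightarrow> ('a, 'b) rmodule \<Rightarrow> bool" where
  "has_krull_dim R M \<longleftrightarrow> trivial_poset (rsubmodules R M) \<or>
    (\<exists>\<alpha> :: ('b set \<times> 'b set) rel. has_dev (rsubmodules R M) \<alpha>)"

definition has_right_krull_dim :: "('a, 'm) ring_scheme \<Rightarrow> bool" where
  "has_right_krull_dim R \<longleftrightarrow> has_krull_dim R (regular_rmodule R)"


subsection \<open>Independence of the types carrying the modules\<close>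

lemma rsubmoduleI:
  assumes "right_module R M" "N \<subseteq> carrier M" "\<zero>\<^bsub>M\<^esub> \<in> N"
    "\<And>x y. x \<in> N \<Longrightarrow> y \<in> N \<Longrightarrow> x \<oplus>\<^bsub>M\<^esub> y \<in> N"
    "\<And>x r. x \<in> N \<Longrightarrow> r \<in> carrier R \<Longrightarrow> x \<cdot>\<^bsub>M\<^esub> r \<in> N"
  shows "rsubmodule R M N"
proof -
  interpret right_module R M by fact
  have "\<ominus>\<^bsub>M\<^esub> x \<in> N" if "x \<in> N" for x
  proof -
    have x: "x \<in> carrier M" using that assms(2) by blast
    have "x \<cdot>\<^bsub>M\<^esub> \<zero>\<^bsub>R\<^esub> = \<zero>\<^bsub>M\<^esub>"
      using rsmult_r_distr[OF x R.zero_closed R.zero_closed] x by simp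
    then have "x \<oplus>\<^bsub>M\<^esub> x \<cdot>\<^bsub>M\<^esub> (\<ominus>\<^bsub>R\<^esub> \<one>\<^bsub>R\<^esub>) = \<zero>\<^bsub>M\<^esub>"
      using rsmult_r_distr[OF x R.one_closed, of "\<ominus>\<^bsub>R\<^esub> \<one>\<^bsub>R\<^esub>"] x by (simp add: R.r_neg)
    then have "\<ominus>\<^bsub>M\<^esub> x = x \<cdot>\<^bsub>M\<^esub> (\<ominus>\<^bsub>R\<^esub> \<one>\<^bsub>R\<^esub>)"
      using x by (metis M.add.inv_equality M.add.m_comm R.add.inv_closed R.one_closed rsmult_closed)
    then show ?thesis using assms(5)[OF that] by simp
  qed
  then have "subgroup N (add_monoid M)"
    using assms(2-4) by (intro M.add.subgroupI) (auto simp: a_inv_def)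
  then show ?thesis using assms(5) by (simp add: rsubmodule_def)
qed

lemma rsubmoduleD:
  assumes "rsubmodule R M N"
  shows "N \<subseteq> carrier M" "\<zero>\<^bsub>M\<^esub> \<in> N" "\<And>x y. x \<in> N \<Longrightarrow> y \<in> N \<Longrightarrow> x \<oplus>\<^bsub>M\<^esub> y \<in> N"
    "\<And>x r. x \<in> N \<Longrightarrow> r \<in> carrier R \<Longrightarrow> x \<cdot>\<^bsub>M\<^esub> r \<in> N" "\<And>x. x \<in> N \<Longrightarrow> \<ominus>\<^bsub>M\<^esub> x \<in> N"
  using assms subgroup.subset[of N "add_monoid M"] subgroup.one_closed[of N "add_monoid M"]
    subgroup.m_closed[of N "add_monoid M"] subgroup.m_inv_closed[of N "add_monoid M"]
  by (auto simp: rsubmodule_def a_inv_def)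

lemma rmodule_homD:
  assumes "f \<in> rmodule_hom R M N"
  shows "\<And>x. x \<in> carrier M \<Longrightarrow> f x \<in> carrier N"
    "\<And>x y. x \<in> carrier M \<Longrightarrow> y \<in> carrier M \<Longrightarrow> f (x \<oplus>\<^bsub>M\<^esub> y) = f x \<oplus>\<^bsub>N\<^esub> f y"
    "\<And>x r. x \<in> carrier M \<Longrightarrow> r \<in> carrier R \<Longrightarrow> f (x \<cdot>\<^bsub>M\<^esub> r) = f x \<cdot>\<^bsub>N\<^esub> r"
  using assms by (auto simp: rmodule_hom_def)

lemma rmodule_hom_zero:
  assumes "right_module R M" "right_module R N" "f \<in> rmodule_hom R M N"
  shows "f \<zero>\<^bsub>M\<^esub> = \<zero>\<^bsub>N\<^esub>"
proof -
  interpret M: right_module R M by fact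
  interpret N: right_module R N by fact
  have "f \<zero>\<^bsub>M\<^esub> \<oplus>\<^bsub>N\<^esub> f \<zero>\<^bsub>M\<^esub> = f \<zero>\<^bsub>M\<^esub>"
    using rmodule_homD(2)[OF assms(3), of "\<zero>\<^bsub>M\<^esub>" "\<zero>\<^bsub>M\<^esub>"] by simp
  then show ?thesis
    using rmodule_homD(1)[OF assms(3), of "\<zero>\<^bsub>M\<^esub>"] by (simp add: N.M.add.r_cancel_one)
qed

lemma rmodule_hom_image:
  assumes "right_module R M" "right_module R N" "f \<in> rmodule_hom R M N" "rsubmodule R M P"
  shows "rsubmodule R N (f ` P)"
proof (rule rsubmoduleI[OF assms(2)])
  note D = rsubmoduleD[OF assms(4)] and H = rmodule_homD[OF assms(3)]
  show "f ` P \<subseteq> carrier N" using D(1) H(1) by auto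
  show "\<zero>\<^bsub>N\<^esub> \<in> f ` P" using rmodule_hom_zero[OF assms(1-3)] D(2) by force
  show "x \<oplus>\<^bsub>N\<^esub> y \<in> f ` P" if xy: "x \<in> f ` P" "y \<in> f ` P" for x y
  proof -
    obtain u v where "u \<in> P" "v \<in> P" "x = f u" "y = f v" using xy by auto
    moreover then have "x \<oplus>\<^bsub>N\<^esub> y = f (u \<oplus>\<^bsub>M\<^esub> v)" using D(1) H(2) by (simp add: subset_iff)
    ultimately show ?thesis using D(3) by blast
  qed
  show "x \<cdot>\<^bsub>N\<^esub> r \<in> f ` P" if xr: "x \<in> f ` P" "r \<in> carrier R" for x r
  proof -
    obtain u where "u \<in> P" "x = f u" using xr by auto
    moreover then have "x \<cdot>\<^bsub>N\<^esub> r = f (u \<cdot>\<^bsub>M\<^esub> r)" using D(1) H(3) xr by (simp add: subset_iff)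
    ultimately show ?thesis using D(4) xr by blast
  qed
qed

lemma rsubmodule_carrier: "right_module R M \<Longrightarrow> rsubmodule R M (carrier M)"
  by (rule rsubmoduleI)
    (auto simp: right_module_def right_module_axioms_def abelian_group_def
      abelian_monoid.zero_closed abelian_monoid.a_closed)

lemma finsum_rmodule_hom:
  assumes "right_module R M" "right_module R N" "f \<in> rmodule_hom R M N"
    "\<And>j. j < n \<Longrightarrow> t j \<in> carrier M"
  shows "f (\<Oplus>\<^bsub>M\<^esub>j\<in>{..<n::nat}. t j) = (\<Oplus>\<^bsub>N\<^esub>j\<in>{..<n}. f (t j))"
  using assms(4)
proof (induction n)
  interpret M: right_module R M by fact
  interpret N: right_module R N by fact
  case 0
  then show ?case using rmodule_hom_zero[OF assms(1-3)] by simp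
next
  interpret M: right_module R M by fact
  interpret N: right_module R N by fact
  case (Suc n)
  have t: "t \<in> {..<n} \<rightarrow> carrier M" "t n \<in> carrier M" using Suc.prems by auto
  then have "(\<lambda>j. f (t j)) \<in> {..<n} \<rightarrow> carrier N" "f (t n) \<in> carrier N"
    using rmodule_homD(1)[OF assms(3)] by auto
  then show ?case
    using Suc t by (simp add: lessThan_Suc rmodule_homD(2)[OF assms(3)] M.M.finsum_closed)
qed

lemma solves_hom:
  assumes "right_module R M" "right_module R N" "f \<in> rmodule_hom R M N" "inj_on f (carrier M)"
    "\<And>i j. i < m \<Longrightarrow> j < n \<Longrightarrow> A i j \<in> carrier R"
    "\<And>i. i < m \<Longrightarrow> p i \<in> carrier M" "\<And>j. j < n \<Longrightarrow> x j \<in> carrier M"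
  shows "solves N m n A (f \<circ> p) (f \<circ> x) \<longleftrightarrow> solves M m n A p x"
proof -
  interpret M: right_module R M by fact
  interpret N: right_module R N by fact
  have "(\<Oplus>\<^bsub>N\<^esub>j\<in>{..<n}. f (x j) \<cdot>\<^bsub>N\<^esub> A i j) = f (p i) \<longleftrightarrow>
      (\<Oplus>\<^bsub>M\<^esub>j\<in>{..<n}. x j \<cdot>\<^bsub>M\<^esub> A i j) = p i" if "i < m" for i
  proof -
    have t: "x j \<cdot>\<^bsub>M\<^esub> A i j \<in> carrier M" if "j < n" for j
      using assms(5,7) \<open>i < m\<close> that by auto
    then have s: "(\<Oplus>\<^bsub>M\<^esub>j\<in>{..<n}. x j \<cdot>\<^bsub>M\<^esub> A i j) \<in> carrier M" by (intro M.M.finsum_closed) auto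
    have "f (\<Oplus>\<^bsub>M\<^esub>j\<in>{..<n}. x j \<cdot>\<^bsub>M\<^esub> A i j) = (\<Oplus>\<^bsub>N\<^esub>j\<in>{..<n}. f (x j \<cdot>\<^bsub>M\<^esub> A i j))"
      by (rule finsum_rmodule_hom[OF assms(1-3) t])
    also have "\<dots> = (\<Oplus>\<^bsub>N\<^esub>j\<in>{..<n}. f (x j) \<cdot>\<^bsub>N\<^esub> A i j)"
      using assms(5,7) \<open>i < m\<close> rmodule_homD[OF assms(3)] by (intro N.M.finsum_cong') auto
    finally show ?thesis
      using inj_on_eq_iff[OF assms(4) s assms(6)[OF \<open>i < m\<close>]] by simp
  qed
  then show ?thesis by (simp add: solves_def)
qed

definition transport ::
  "('b \<Rightarrow> 'c) \<Rightarrow> 'b set \<Rightarrow> ('a, 'b) rmodule \<Rightarrow> ('a, 'c) rmodule" where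
  "transport h N M =
    \<lparr>carrier = h ` N, mult = undefined, one = undefined, zero = h \<zero>\<^bsub>M\<^esub>,
     add = (\<lambda>u v. h (inv_into N h u \<oplus>\<^bsub>M\<^esub> inv_into N h v)),
     rsmult = (\<lambda>u r. h (inv_into N h u \<cdot>\<^bsub>M\<^esub> r))\<rparr>"

lemma transport:
  fixes M :: "('a, 'b) rmodule" and h :: "'b \<Rightarrow> 'c"
  assumes "right_module R M" "rsubmodule R M N" "inj_on h N"
  shows "right_module R (transport h N M)"
    "inv_into N h \<in> rmodule_hom R (transport h N M) M"
    "\<And>(L :: ('a, 'd) rmodule) f. f \<in> rmodule_hom R L M \<Longrightarrow> f ` carrier L \<subseteq> N \<Longrightarrow>
      h \<circ> f \<in> rmodule_hom R L (transport h N M)"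
proof -
  interpret right_module R M by fact
  note D = rsubmoduleD[OF assms(2)]
  have c [simp]: "x \<in> carrier M" if "x \<in> N" for x using D(1) that by blast
  have k [simp]: "inv_into N h (h x) = x" if "x \<in> N" for x
    using assms(3) that by simp
  note [simp] = D(2-5)
  have "abelian_group (transport h N M)"
  proof (rule abelian_groupI)
    fix u assume "u \<in> carrier (transport h N M)"
    then obtain x where x: "x \<in> N" "u = h x" by (auto simp: transport_def)
    show "\<exists>v\<in>carrier (transport h N M). v \<oplus>\<^bsub>transport h N M\<^esub> u = \<zero>\<^bsub>transport h N M\<^esub>"
      using x by (intro bexI[of _ "h (\<ominus>\<^bsub>M\<^esub> x)"]) (auto simp: transport_def M.l_neg)
  qed (auto simp: transport_def M.add.m_ac)
  then show "right_module R (transport h N M)"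
    by (intro right_module.intro right_module_axioms.intro R.ring_axioms)
      (auto simp: transport_def rsmult_r_distr rsmult_l_distr rsmult_assoc)
  show "inv_into N h \<in> rmodule_hom R (transport h N M) M"
    by (auto simp: rmodule_hom_def transport_def)
  show "h \<circ> f \<in> rmodule_hom R L (transport h N M)"
    if "f \<in> rmodule_hom R L M" "f ` carrier L \<subseteq> N" for L :: "('a, 'd) rmodule" and f
    using that by (auto simp: rmodule_hom_def transport_def image_subset_iff)
qed

theorem absolutely_pure_all_types:
  fixes M :: "('a, 'b) rmodule" and N :: "('a, 'c) rmodule"
  assumes "absolutely_pure R M" "right_module R N"
    "f \<in> rmodule_hom R M N" "inj_on f (carrier M)"
  shows "pure_rsubmodule R N (f ` carrier M)"
proof -
  have rM: "right_module R M" using assms(1) by (simp add: absolutely_pure_def)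
  interpret M: right_module R M by fact
  interpret N: right_module R N by fact
  note H = rmodule_homD[OF assms(3)]
  have "\<exists>y. (\<forall>j<n. y j \<in> f ` carrier M) \<and> solves N m n A p y"
    if A: "\<forall>i<m. \<forall>j<n. A i j \<in> carrier R" and p: "\<forall>i<m. p i \<in> f ` carrier M"
      and x: "\<forall>j<n. x j \<in> carrier N" and sol: "solves N m n A p x" for m n A p x
  proof -
    define g :: "'b \<times> (nat \<Rightarrow> 'a) \<Rightarrow> 'c"
      where "g = (\<lambda>(u, c). f u \<oplus>\<^bsub>N\<^esub> (\<Oplus>\<^bsub>N\<^esub>j\<in>{..<n}. x j \<cdot>\<^bsub>N\<^esub> c j))"
    define D where "D = carrier M \<times> {c :: nat \<Rightarrow> 'a. \<forall>j. c j \<in> carrier R}"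
    have x0: "x j \<cdot>\<^bsub>N\<^esub> \<zero>\<^bsub>R\<^esub> = \<zero>\<^bsub>N\<^esub>" if "j < n" for j
      using N.rsmult_r_distr[of "x j" "\<zero>\<^bsub>R\<^esub>" "\<zero>\<^bsub>R\<^esub>"] x that by simp
    have sc: "(\<Oplus>\<^bsub>N\<^esub>j\<in>{..<n}. x j \<cdot>\<^bsub>N\<^esub> c j) \<in> carrier N" if "\<forall>j. c j \<in> carrier R" for c
      using that x by (intro N.M.finsum_closed) auto
    have g0: "g (u, \<lambda>_. \<zero>\<^bsub>R\<^esub>) = f u" if "u \<in> carrier M" for u
    proof -
      have "(\<Oplus>\<^bsub>N\<^esub>j\<in>{..<n}. x j \<cdot>\<^bsub>N\<^esub> \<zero>\<^bsub>R\<^esub>) = (\<Oplus>\<^bsub>N\<^esub>j\<in>{..<n}. \<zero>\<^bsub>N\<^esub>)"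
        using x0 by (intro N.M.finsum_cong') auto
      then show ?thesis using that H(1) by (simp add: g_def)
    qed
    have fM: "f ` carrier M \<subseteq> g ` D"
    proof
      fix y assume "y \<in> f ` carrier M"
      then obtain u where "u \<in> carrier M" "y = f u" by auto
      then show "y \<in> g ` D"
        using g0[of u] by (intro image_eqI[of _ _ "(u, \<lambda>_. \<zero>\<^bsub>R\<^esub>)"]) (auto simp: D_def)
    qed
    have xj: "x k \<in> g ` D" if "k < n" for k
    proof -
      let ?c = "\<lambda>j. if j = k then \<one>\<^bsub>R\<^esub> else \<zero>\<^bsub>R\<^esub>"
      have "(\<Oplus>\<^bsub>N\<^esub>j\<in>{..<n}. x j \<cdot>\<^bsub>N\<^esub> ?c j) = (\<Oplus>\<^bsub>N\<^esub>j\<in>{..<n}. if k = j then x j else \<zero>\<^bsub>N\<^esub>)"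
        using x0 x by (intro N.M.finsum_cong') auto
      also have "\<dots> = x k" using that x by (intro N.M.finsum_singleton) auto
      finally have "g (\<zero>\<^bsub>M\<^esub>, ?c) = x k"
        using that x rmodule_hom_zero[OF rM assms(2,3)] by (simp add: g_def)
      then show ?thesis by (intro image_eqI[of _ _ "(\<zero>\<^bsub>M\<^esub>, ?c)"]) (auto simp: D_def)
    qed
    have sub: "rsubmodule R N (g ` D)"
    proof (rule rsubmoduleI[OF assms(2)])
      show "g ` D \<subseteq> carrier N" using sc H(1) by (auto simp: g_def D_def)
      show "\<zero>\<^bsub>N\<^esub> \<in> g ` D" using fM rmodule_hom_zero[OF rM assms(2,3)] by force
    next
      fix y z assume "y \<in> g ` D" "z \<in> g ` D"
      then obtain u c v d where *: "u \<in> carrier M" "\<forall>j. c j \<in> carrier R" "y = g (u, c)"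
        "v \<in> carrier M" "\<forall>j. d j \<in> carrier R" "z = g (v, d)"
        unfolding D_def by auto
      have "(\<Oplus>\<^bsub>N\<^esub>j\<in>{..<n}. x j \<cdot>\<^bsub>N\<^esub> (c j \<oplus>\<^bsub>R\<^esub> d j)) =
          (\<Oplus>\<^bsub>N\<^esub>j\<in>{..<n}. x j \<cdot>\<^bsub>N\<^esub> c j \<oplus>\<^bsub>N\<^esub> x j \<cdot>\<^bsub>N\<^esub> d j)"
        using * x by (intro N.M.finsum_cong') (auto simp: N.rsmult_r_distr)
      also have "\<dots> = (\<Oplus>\<^bsub>N\<^esub>j\<in>{..<n}. x j \<cdot>\<^bsub>N\<^esub> c j) \<oplus>\<^bsub>N\<^esub> (\<Oplus>\<^bsub>N\<^esub>j\<in>{..<n}. x j \<cdot>\<^bsub>N\<^esub> d j)"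
        using * x by (intro N.M.finsum_addf) auto
      finally have "y \<oplus>\<^bsub>N\<^esub> z = g (u \<oplus>\<^bsub>M\<^esub> v, \<lambda>j. c j \<oplus>\<^bsub>R\<^esub> d j)"
        using * sc H by (simp add: g_def N.M.add.m_ac)
      then show "y \<oplus>\<^bsub>N\<^esub> z \<in> g ` D" using * by (auto simp: D_def)
    next
      fix y r assume "y \<in> g ` D" and r: "r \<in> carrier R"
      then obtain u c where *: "u \<in> carrier M" "\<forall>j. c j \<in> carrier R" "y = g (u, c)"
        unfolding D_def by auto
      have hom: "(\<lambda>z. z \<cdot>\<^bsub>N\<^esub> r) (\<Oplus>\<^bsub>N\<^esub>j\<in>{..<k}. x j \<cdot>\<^bsub>N\<^esub> c j) =
          (\<Oplus>\<^bsub>N\<^esub>j\<in>{..<k}. x j \<cdot>\<^bsub>N\<^esub> (c j \<otimes>\<^bsub>R\<^esub> r))" if "k \<le> n" for k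
        using that
      proof (induction k)
        case 0
        have "\<zero>\<^bsub>N\<^esub> \<cdot>\<^bsub>N\<^esub> r \<oplus>\<^bsub>N\<^esub> \<zero>\<^bsub>N\<^esub> \<cdot>\<^bsub>N\<^esub> r = \<zero>\<^bsub>N\<^esub> \<cdot>\<^bsub>N\<^esub> r"
          using N.rsmult_l_distr[of "\<zero>\<^bsub>N\<^esub>" "\<zero>\<^bsub>N\<^esub>" r] r by simp
        then show ?case using r by (simp add: N.M.add.r_cancel_one)
      next
        case (Suc k)
        have "(\<lambda>j. x j \<cdot>\<^bsub>N\<^esub> c j) \<in> {..<k} \<rightarrow> carrier N"
          "(\<lambda>j. x j \<cdot>\<^bsub>N\<^esub> (c j \<otimes>\<^bsub>R\<^esub> r)) \<in> {..<k} \<rightarrow> carrier N" "x k \<in> carrier N"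
          using Suc.prems x * r by auto
        then show ?case
          using Suc * r
          by (simp add: lessThan_Suc N.rsmult_l_distr N.rsmult_assoc N.M.finsum_closed)
      qed
      have "y \<cdot>\<^bsub>N\<^esub> r = g (u \<cdot>\<^bsub>M\<^esub> r, \<lambda>j. c j \<otimes>\<^bsub>R\<^esub> r)"
        using * r sc H hom[of n] by (simp add: g_def N.rsmult_l_distr)
      then show "y \<cdot>\<^bsub>N\<^esub> r \<in> g ` D" using * r by (auto simp: D_def)
    qed
    define h where "h = inv_into D g"
    define K where "K = transport h (g ` D) N"
    define k where "k = inv_into (g ` D) h"
    have injh: "inj_on h (g ` D)" unfolding h_def by (rule inj_on_inv_into) simp
    have K: "right_module R K" and k: "k \<in> rmodule_hom R K N" and hf: "h \<circ> f \<in> rmodule_hom R M K"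
      using transport[OF assms(2) sub injh] assms(3) fM unfolding K_def k_def by auto
    have cK: "carrier K = h ` g ` D" by (simp add: K_def transport_def)
    have kh: "k (h y) = y" if "y \<in> g ` D" for y unfolding k_def using injh that by simp
    have injk: "inj_on k (carrier K)" unfolding cK k_def by (rule inj_on_inv_into) simp
    have "inj_on (h \<circ> f) (carrier M)"
      using assms(4) injh fM by (auto intro: comp_inj_on inj_on_subset)
    then have pure: "pure_rsubmodule R K ((h \<circ> f) ` carrier M)"
      using assms(1) K hf unfolding absolutely_pure_def by blast
    have pD: "p i \<in> g ` D" if "i < m" for i using p fM that by blast
    have cong: "solves N m n A (k \<circ> (h \<circ> p)) y \<longleftrightarrow> solves N m n A p y" for y
      by (simp add: solves_def kh pD)
    have "solves N m n A (k \<circ> (h \<circ> p)) (k \<circ> (h \<circ> x))"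
    proof -
      have "(\<Oplus>\<^bsub>N\<^esub>j\<in>{..<n}. k (h (x j)) \<cdot>\<^bsub>N\<^esub> A i j) = (\<Oplus>\<^bsub>N\<^esub>j\<in>{..<n}. x j \<cdot>\<^bsub>N\<^esub> A i j)"
        if "i < m" for i
        using x A that by (intro N.M.finsum_cong') (auto simp: kh xj)
      then show ?thesis using sol unfolding cong by (simp add: solves_def)
    qed
    then have "solves K m n A (h \<circ> p) (h \<circ> x)"
      using solves_hom[OF K assms(2) k injk, of m n A "h \<circ> p" "h \<circ> x"] A pD xj cK by auto
    moreover have "\<forall>j<n. (h \<circ> x) j \<in> carrier K" using xj cK by auto
    moreover have "\<forall>i<m. (h \<circ> p) i \<in> (h \<circ> f) ` carrier M" using p by (force simp: image_comp[symmetric])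
    ultimately obtain y where y: "\<forall>j<n. y j \<in> (h \<circ> f) ` carrier M" "solves K m n A (h \<circ> p) y"
      using pure A unfolding pure_rsubmodule_def by blast
    have "y j \<in> carrier K" if "j < n" for j using y(1) that rmodule_homD(1)[OF hf] by auto
    then have "solves N m n A p (k \<circ> y)"
      using solves_hom[OF K assms(2) k injk, of m n A "h \<circ> p" y] A pD cK y(2) cong by auto
    moreover have "(k \<circ> y) j \<in> f ` carrier M" if "j < n" for j
    proof -
      have "y j \<in> (h \<circ> f) ` carrier M" using y(1) that by blast
      then obtain u where "u \<in> carrier M" "y j = h (f u)" unfolding image_iff comp_def by blast
      moreover then have "k (h (f u)) = f u" using kh fM by blast
      ultimately show ?thesis by simp
    qed
    ultimately show ?thesis by blast
  qed
  then show ?thesis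
    using rmodule_hom_image[OF rM assms(2,3) rsubmodule_carrier[OF rM]]
    unfolding pure_rsubmodule_def by blast
qed

theorem right_SAP_all_types:
  fixes S :: "('a, 'c) rmodule"
  assumes "right_SAP R" "simple_rmodule R S"
  shows "absolutely_pure R S"
proof -
  have rS: "right_module R S" using assms(2) by (simp add: simple_rmodule_def)
  interpret right_module R S by fact
  obtain x where x: "x \<in> carrier S" "x \<noteq> \<zero>\<^bsub>S\<^esub>"
    using assms(2) M.zero_closed by (auto simp: simple_rmodule_def)
  define g where "g r = x \<cdot>\<^bsub>S\<^esub> r" for r
  have "rsubmodule R S (g ` carrier R)"
  proof (rule rsubmoduleI[OF rS])
    have "x \<cdot>\<^bsub>S\<^esub> \<zero>\<^bsub>R\<^esub> = \<zero>\<^bsub>S\<^esub>"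
      using rsmult_r_distr[of x "\<zero>\<^bsub>R\<^esub>" "\<zero>\<^bsub>R\<^esub>"] x by simp
    then show "\<zero>\<^bsub>S\<^esub> \<in> g ` carrier R"
      by (intro image_eqI[of _ _ "\<zero>\<^bsub>R\<^esub>"]) (auto simp: g_def)
  qed (use x in \<open>auto simp: g_def rsmult_r_distr[symmetric] rsmult_assoc[symmetric]\<close>)
  moreover have "x \<in> g ` carrier R"
    using x by (intro image_eqI[of _ _ "\<one>\<^bsub>R\<^esub>"]) (auto simp: g_def)
  ultimately have gS: "g ` carrier R = carrier S"
    using assms(2) x unfolding simple_rmodule_def by blast
  define h where "h s = {inv_into (carrier R) g s}" for s
  have injh: "inj_on h (carrier S)"
    using inj_on_inv_into[of "carrier S" g "carrier R"] gS by (auto simp: h_def inj_on_def)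
  define K where "K = transport h (carrier S) S"
  define k where "k = inv_into (carrier S) h"
  have K: "right_module R K" and k: "k \<in> rmodule_hom R K S"
    using transport[OF rS rsubmodule_carrier[OF rS] injh] unfolding K_def k_def by auto
  have cK: "carrier K = h ` carrier S" by (simp add: K_def transport_def)
  have kK: "k ` carrier K = carrier S"
    unfolding cK k_def using injh by (simp add: inv_into_image_cancel)
  have injk: "inj_on k (carrier K)" unfolding cK k_def by (rule inj_on_inv_into) simp
  have k0: "k \<zero>\<^bsub>K\<^esub> = \<zero>\<^bsub>S\<^esub>" by (rule rmodule_hom_zero[OF K rS k])
  have "simple_rmodule R K"
    unfolding simple_rmodule_def
  proof (intro conjI allI impI)
    show "carrier K \<noteq> {\<zero>\<^bsub>K\<^esub>}" using kK k0 x by auto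
    fix P assume P: "rsubmodule R K P"
    then have "k ` P = {\<zero>\<^bsub>S\<^esub>} \<or> k ` P = carrier S"
      using rmodule_hom_image[OF K rS k] assms(2) unfolding simple_rmodule_def by blast
    moreover have "P \<subseteq> carrier K" "\<zero>\<^bsub>K\<^esub> \<in> P" using rsubmoduleD[OF P] by auto
    ultimately show "P = {\<zero>\<^bsub>K\<^esub>} \<or> P = carrier K"
      using kK k0 injk inj_on_image_eq_iff[OF injk, of P "{\<zero>\<^bsub>K\<^esub>}"]
        inj_on_image_eq_iff[OF injk, of P "carrier K"] by auto
  qed (fact K)
  then have ap: "absolutely_pure R K" using assms(1) by (auto simp: right_SAP_def)
  have "pure_rsubmodule R N (f ` carrier S)"
    if "right_module R N" "f \<in> rmodule_hom R S N" "inj_on f (carrier S)"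
    for N :: "('a, 'c \<times> (nat \<Rightarrow> 'a)) rmodule" and f
  proof -
    have "f \<circ> k \<in> rmodule_hom R K N"
      using that(2) k by (auto simp: rmodule_hom_def Pi_iff)
    moreover have "inj_on (f \<circ> k) (carrier K)" using that(3) injk kK by (simp add: comp_inj_on)
    ultimately have "pure_rsubmodule R N ((f \<circ> k) ` carrier K)"
      using absolutely_pure_all_types[OF ap that(1)] by blast
    then show ?thesis unfolding image_comp[symmetric] kK .
  qed
  then show ?thesis using rS unfolding absolutely_pure_def by blast
qed


subsection \<open>Independence of the type representing ordinals\<close>

lemma has_dev_Well_order: "has_dev A \<alpha> \<Longrightarrow> Well_order \<alpha>"
  by (simp add: has_dev.simps[of A \<alpha>])

lemma ordLess_transfer:
  fixes \<alpha> :: "'i rel" and \<alpha>' :: "'j rel"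
  assumes "\<beta> <o \<alpha>" "\<alpha> =o \<alpha>'"
  obtains \<beta>' :: "'j rel" where "\<beta>' <o \<alpha>'" "\<beta> =o \<beta>'"
proof -
  have "\<beta> <o \<alpha>'" using assms ordLess_ordIso_trans by blast
  then show ?thesis using that internalize_ordLess[of \<beta> \<alpha>'] by blast
qed

lemma ordIso_empty: "\<alpha> =o \<alpha>' \<Longrightarrow> \<alpha> = {} \<Longrightarrow> \<alpha>' = {}"
proof -
  assume "\<alpha> =o \<alpha>'" "\<alpha> = {}"
  then obtain f where "bij_betw f (Field \<alpha>) (Field \<alpha>')"
    by (auto simp: ordIso_def BNF_Wellorder_Embedding.iso_def)
  with \<open>\<alpha> = {}\<close> have "Field \<alpha>' = {}" by (simp add: bij_betw_def)
  then show "\<alpha>' = {}" by (auto simp: Field_def)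
qed

lemma has_dev_cong:
  fixes \<alpha> :: "'i rel" and \<alpha>' :: "'j rel"
  assumes "\<alpha> =o \<alpha>'"
  shows "has_dev A \<alpha> \<longleftrightarrow> has_dev A \<alpha>'"
  using assms
proof (induction \<alpha> arbitrary: \<alpha>' A rule: wf_induct_rule[OF wf_ordLess])
  case (1 \<alpha>)
  have "(\<exists>\<beta>\<in>{\<beta> :: 'i rel. \<beta> <o \<alpha>}. has_dev B \<beta>) \<longleftrightarrow> (\<exists>\<beta>\<in>{\<beta> :: 'j rel. \<beta> <o \<alpha>'}. has_dev B \<beta>)" for B :: "'a set"
  proof
    assume "\<exists>\<beta>\<in>{\<beta> :: 'i rel. \<beta> <o \<alpha>}. has_dev B \<beta>"
    then obtain \<beta> :: "'i rel" where \<beta>: "\<beta> <o \<alpha>" "has_dev B \<beta>" by blast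
    then obtain \<beta>' :: "'j rel" where "\<beta>' <o \<alpha>'" "\<beta> =o \<beta>'"
      using ordLess_transfer 1(2) by blast
    with \<beta> 1(1) show "\<exists>\<beta>\<in>{\<beta> :: 'j rel. \<beta> <o \<alpha>'}. has_dev B \<beta>" by blast
  next
    assume "\<exists>\<beta>\<in>{\<beta> :: 'j rel. \<beta> <o \<alpha>'}. has_dev B \<beta>"
    then obtain \<beta> :: "'j rel" where \<beta>: "\<beta> <o \<alpha>'" "has_dev B \<beta>" by blast
    then obtain \<beta>' :: "'i rel" where "\<beta>' <o \<alpha>" "\<beta> =o \<beta>'"
      using ordLess_transfer 1(2) ordIso_symmetric by blast
    with \<beta> 1(1) ordIso_symmetric show "\<exists>\<beta>\<in>{\<beta> :: 'i rel. \<beta> <o \<alpha>}. has_dev B \<beta>" by blast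
  qed
  moreover have "\<alpha> = {} \<longleftrightarrow> \<alpha>' = {}"
    using ordIso_empty[OF 1(2)] ordIso_empty[OF ordIso_symmetric[OF 1(2)]] by blast
  moreover have "Well_order \<alpha>" "Well_order \<alpha>'"
    using 1(2) by (auto simp: ordIso_def)
  ultimately show ?case
    by (simp add: has_dev.simps[of A \<alpha>] has_dev.simps[of A \<alpha>'] Let_def)
qed

lemma ordLess_linear: "Well_order (\<alpha> :: 'i rel) \<Longrightarrow> Well_order (\<beta> :: 'i rel) \<Longrightarrow>
  \<alpha> <o \<beta> \<or> \<alpha> =o \<beta> \<or> \<beta> <o \<alpha>"
  using ordLess_or_ordLeq ordLeq_iff_ordLess_or_ordIso ordIso_symmetric by metis

lemma empty_least: "\<beta> <o \<alpha> \<Longrightarrow> \<alpha> \<noteq> {}"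
  using internalize_ordLess[of \<beta> \<alpha>] by auto

lemma has_dev_unique:
  fixes \<alpha> \<beta> :: "'i rel"
  assumes "has_dev A \<alpha>" "has_dev A \<beta>"
  shows "\<alpha> =o \<beta>"
proof -
  have *: False if "\<gamma> <o \<delta>" "has_dev A \<gamma>" "has_dev A \<delta>" for \<gamma> \<delta> :: "'i rel"
    using that empty_least[OF that(1)] by (auto simp: has_dev.simps[of A \<delta>] Let_def)
  show ?thesis
    using *[of \<alpha> \<beta>] *[of \<beta> \<alpha>] assms ordLess_linear[of \<alpha> \<beta>] has_dev_Well_order by blast
qed

lemma interval_of_interval_of:
  "l \<in> interval_of A x y \<Longrightarrow> u \<in> interval_of A x y \<Longrightarrow>
    interval_of (interval_of A x y) l u = interval_of A l u"
  by (auto simp: interval_of_def)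

lemma smaller_deviation_attained:
  fixes \<alpha> \<beta> :: "'i rel"
  assumes "has_dev A \<alpha>" "\<beta> <o \<alpha>"
  shows "\<exists>x y. has_dev (interval_of A x y) \<beta>"
proof (rule ccontr)
  assume no: "\<nexists>x y. has_dev (interval_of A x y) \<beta>"
  have wo: "Well_order \<beta>" using assms(2) by (auto simp: ordLess_def)
  have "\<not> \<beta> <o \<gamma>" if "B = A \<or> (\<exists>x y. B = interval_of A x y)" "has_dev B \<gamma>" for B and \<gamma> :: "'i rel"
    using that
  proof (induction \<gamma> arbitrary: B rule: wf_induct_rule[OF wf_ordLess])
    case (1 \<gamma>)
    show ?case
    proof
      assume lt: "\<beta> <o \<gamma>"
      note ne = empty_least[OF lt]
      have dev: "\<not> trivial_poset B" "\<And>\<delta> :: 'i rel. \<delta> <o \<gamma> \<Longrightarrow> \<not> has_dev B \<delta>"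
        and fin: "\<And>a. descending_chain B a \<Longrightarrow> finite {i. \<not> (trivial_poset (interval_of B (a (Suc i)) (a i)) \<or>
            (\<exists>\<delta>\<in>{\<delta> :: 'i rel. \<delta> <o \<gamma>}. has_dev (interval_of B (a (Suc i)) (a i)) \<delta>))}"
        using 1(3)[unfolded has_dev.simps[of B \<gamma>]] ne unfolding Let_def by simp_all
      have small: "trivial_poset (interval_of B (a (Suc i)) (a i)) \<or>
            (\<exists>\<delta>\<in>{\<delta> :: 'i rel. \<delta> <o \<beta>}. has_dev (interval_of B (a (Suc i)) (a i)) \<delta>)"
        if "descending_chain B a" "trivial_poset (interval_of B (a (Suc i)) (a i)) \<or>
            (\<exists>\<delta>\<in>{\<delta> :: 'i rel. \<delta> <o \<gamma>}. has_dev (interval_of B (a (Suc i)) (a i)) \<delta>)" for a i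
      proof -
        have eq: "interval_of B (a (Suc i)) (a i) = interval_of A (a (Suc i)) (a i)"
          using that(1) 1(2) interval_of_interval_of
          unfolding descending_chain_def by metis
        have "\<delta> <o \<beta>" if "\<delta> <o \<gamma>" "has_dev (interval_of B (a (Suc i)) (a i)) \<delta>" for \<delta> :: "'i rel"
        proof -
          have "\<not> \<beta> <o \<delta>" using 1(1)[OF that(1)] that(2) eq by auto
          moreover have "\<not> \<delta> =o \<beta>" using no that(2) eq has_dev_cong by metis
          ultimately show ?thesis using ordLess_linear wo has_dev_Well_order[OF that(2)] by blast
        qed
        then show ?thesis using that(2) by blast
      qed
      have fin': "finite {i. \<not> (trivial_poset (interval_of B (a (Suc i)) (a i)) \<or>
            (\<exists>\<delta>\<in>{\<delta> :: 'i rel. \<delta> <o \<beta>}. has_dev (interval_of B (a (Suc i)) (a i)) \<delta>))}"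
        if "descending_chain B a" for a
        by (rule finite_subset[OF _ fin[OF that]]) (use small[OF that] in blast)
      have "has_dev B \<beta>"
      proof (cases "\<beta> = {}")
        case False
        then show ?thesis
          using dev fin' wo ordLess_transitive[OF _ lt]
          unfolding has_dev.simps[of B \<beta>] Let_def by auto
      next
        case True
        have "\<exists>n. \<forall>i\<ge>n. a i = a n" if a: "descending_chain B a" for a
        proof -
          have "\<not> \<delta> <o \<beta>" for \<delta> :: "'i rel" using True empty_least by blast
          then have "finite {i. \<not> trivial_poset (interval_of B (a (Suc i)) (a i))}"
            using fin'[OF a] by simp
          then obtain n where n: "\<And>i. i \<ge> n \<Longrightarrow> trivial_poset (interval_of B (a (Suc i)) (a i))"
            by (metis (mono_tags, lifting) finite_nat_set_iff_bounded mem_Collect_eq not_le)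
          have step: "a (Suc i) = a i" if "i \<ge> n" for i
            using n[OF that] a
            unfolding trivial_poset_def interval_of_def descending_chain_def by blast
          have "a i = a n" if "i \<ge> n" for i
            using that by (induction rule: dec_induct) (auto simp: step)
          then show ?thesis by blast
        qed
        then show ?thesis using True dev(1) wo unfolding has_dev.simps[of B \<beta>] by auto
      qed
      then show False using dev(2) lt by blast
    qed
  qed
  then show False using assms by blast
qed

theorem has_dev_all_types:
  fixes A :: "'p::order set" and \<alpha> :: "'i rel"
  assumes "has_dev A \<alpha>"
  shows "\<exists>\<alpha>' :: ('p \<times> 'p) rel. \<alpha> =o \<alpha>' \<and> has_dev A \<alpha>'"
proof -
  have wo: "Well_order \<alpha>" by (rule has_dev_Well_order[OF assms])
  have "\<forall>a. \<exists>p. a \<in> Field \<alpha> \<longrightarrow>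
      has_dev (interval_of A (fst p) (snd p)) (Restr \<alpha> (underS \<alpha> a))"
    using underS_Restr_ordLess[OF wo] smaller_deviation_attained[OF assms] by fastforce
  then obtain f :: "'i \<Rightarrow> 'p \<times> 'p" where f: "\<And>a. a \<in> Field \<alpha> \<Longrightarrow>
      has_dev (interval_of A (fst (f a)) (snd (f a))) (Restr \<alpha> (underS \<alpha> a))"
    by metis
  have lt: "Restr \<alpha> (underS \<alpha> a) <o Restr \<alpha> (underS \<alpha> b)"
    if "a \<in> Field \<alpha>" "b \<in> Field \<alpha>" "(a, b) \<in> \<alpha>" "a \<noteq> b" for a b
  proof -
    have wr: "wo_rel \<alpha>" using wo by (simp add: wo_rel_def)
    have "underS \<alpha> a \<subset> underS \<alpha> b"
      using that wo_rel.ANTISYM[OF wr] wo_rel.TRANS[OF wr] unfolding underS_def antisym_def trans_def by blast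
    then show ?thesis
      using ofilter_subset_ordLess[OF wo] wo_rel.underS_ofilter[OF wr] by blast
  qed
  have "inj_on f (Field \<alpha>)"
  proof (rule inj_onI, rule ccontr)
    fix a b assume ab: "a \<in> Field \<alpha>" "b \<in> Field \<alpha>" "f a = f b" "a \<noteq> b"
    then have iso: "Restr \<alpha> (underS \<alpha> a) =o Restr \<alpha> (underS \<alpha> b)"
      using f has_dev_unique by metis
    have "(a, b) \<in> \<alpha> \<or> (b, a) \<in> \<alpha>"
      using wo ab by (auto simp: order_on_defs total_on_def)
    then show False
      using lt ab iso ordIso_symmetric not_ordLess_ordIso by metis
  qed
  then have "\<alpha> =o dir_image \<alpha> f" using dir_image_ordIso wo by blast
  then show ?thesis using assms has_dev_cong by blast
qed

end

theory Submission
  imports Defs "HOL-Algebra.AbelCoset" "HOL-Library.Nat_Bijection"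
begin

text \<open>
  A poset with the ascending chain condition has a deviation, which gives one direction for every
  ring. Conversely, let \<open>I\<^sub>0 \<subset> I\<^sub>1 \<subset> \<dots>\<close> be right ideals and \<open>a\<^sub>n \<in> I\<^sub>n\<^sub>+\<^sub>1 - I\<^sub>n\<close>. Let \<open>K\<close> be a right ideal
  that is maximal among those containing \<open>I\<^sub>n\<close> but not \<open>a\<^sub>n\<close>. Then \<open>S = (a\<^sub>n R + K) / K\<close> is simple,
  hence pure in \<open>R / K\<close>. The equations \<open>x a\<^sub>i = 0\<close> (\<open>i < n\<close>), \<open>x a\<^sub>n = a\<^sub>n + K\<close> are solved by
  \<open>1 + K\<close>, so they have a solution \<open>s\<close> in \<open>S\<close>, and the annihilator \<open>L\<^sub>n\<close> of \<open>s\<close> is a maximal right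
  ideal that contains all \<open>a\<^sub>i\<close> with \<open>i < n\<close> but not \<open>a\<^sub>n\<close>. Triangular elimination yields elements
  outside \<open>L\<^sub>m\<close> that lie in all other \<open>L\<^sub>n\<close>. Therefore the intersections of the \<open>L\<^sub>n\<close> embed the
  power set of the natural numbers into the lattice of right ideals, and this power set has no
  deviation.
\<close>

section \<open>Posets with and without deviation\<close>

text \<open>\<open>A\<close> and \<open>f\<close> must vary in the induction: it passes from
  \<open>A\<close> to a factor of a chain, into which the power set is mapped by a new
  function.\<close>

lemma has_dev_no_strict_mono_Pow:
  fixes f :: "nat set \<Rightarrow> 'p::order" and \<alpha> :: "'i rel"
  assumes "has_dev A \<alpha>" "\<And>X. f X \<in> A" "strict_mono f"
  shows False
  using assms
proof (induction \<alpha> arbitrary: A f rule: wf_induct_rule[OF wf_ordLess])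
  case (1 \<alpha>)
  text \<open>The sets \<open>X i\<close> decrease with infinite differences, so every factor of the chain
    \<open>f (X i)\<close> again receives a copy of the power set.\<close>
  define X where "X i = {prod_encode (k, m) | k m. i \<le> k}" for i
  have sub: "X (Suc i) \<union> (\<lambda>m. prod_encode (i, m)) ` Y \<subseteq> X i" for i Y
    by (auto simp: X_def)
  have chain: "descending_chain A (\<lambda>i. f (X i))"
    using 1(3) sub[of _ "{}"] strict_mono_mono[OF 1(4)]
    by (auto simp: descending_chain_def mono_def)
  \<comment> \<open>The codes of pairs with first component \<open>i\<close> form the gap between
    \<open>X (Suc i)\<close> and \<open>X i\<close>. Filling it with a copy of \<open>Y\<close>
    keeps the value of \<open>f\<close> inside the factor at \<open>i\<close>.\<close>
  define g where "g i Y = f (X (Suc i) \<union> (\<lambda>m. prod_encode (i, m)) ` Y)" for i Y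
  have g_mono: "strict_mono (g i)" for i
  proof (rule strict_monoI)
    fix Y Z :: "nat set" assume YZ: "Y < Z"
    have iff: "prod_encode (i, m) \<in> X (Suc i) \<union> (\<lambda>m. prod_encode (i, m)) ` W \<longleftrightarrow> m \<in> W" for m W
      by (auto simp: X_def)
    obtain m where "m \<in> Z" "m \<notin> Y" using YZ by blast
    then have "X (Suc i) \<union> (\<lambda>m. prod_encode (i, m)) ` Y \<noteq> X (Suc i) \<union> (\<lambda>m. prod_encode (i, m)) ` Z"
      using iff by metis
    then have "X (Suc i) \<union> (\<lambda>m. prod_encode (i, m)) ` Y < X (Suc i) \<union> (\<lambda>m. prod_encode (i, m)) ` Z"
      using YZ by auto
    then show "g i Y < g i Z" unfolding g_def by (rule strict_monoD[OF 1(4)])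
  qed
  have g_in: "g i Y \<in> interval_of A (f (X (Suc i))) (f (X i))" for i Y
    using 1(3) sub[of i Y] strict_mono_mono[OF 1(4)]
    by (auto simp: interval_of_def g_def mono_def)
  have nontriv: "\<not> trivial_poset (interval_of A (f (X (Suc i))) (f (X i)))" for i
  proof
    assume "trivial_poset (interval_of A (f (X (Suc i))) (f (X i)))"
    moreover have "g i {} < g i UNIV" by (rule strict_monoD[OF g_mono]) auto
    ultimately show False
      using g_in[of i "{}"] g_in[of i UNIV] unfolding trivial_poset_def by force
  qed
  show False
  proof (cases "\<alpha> = {}")
    case True
    then obtain n where "\<forall>i\<ge>n. f (X i) = f (X n)"
      using 1(2) chain unfolding has_dev.simps[of A \<alpha>] by auto
    then have eq: "f (X (Suc n)) = f (X n)" by (metis le_SucI order_refl)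
    have "trivial_poset (interval_of A (f (X (Suc n))) (f (X n)))"
      unfolding trivial_poset_def interval_of_def eq
      by (metis (no_types, lifting) mem_Collect_eq order.antisym)
    then show False using nontriv by blast
  next
    case False
    have "finite {i. \<not> (trivial_poset (interval_of A (a (Suc i)) (a i)) \<or>
      (\<exists>\<beta>\<in>{\<beta> :: 'i rel. \<beta> <o \<alpha>}. has_dev (interval_of A (a (Suc i)) (a i)) \<beta>))}"
      if "descending_chain A a" for a
      using 1(2)[unfolded has_dev.simps[of A \<alpha>]] False that unfolding Let_def by simp
    \<comment> \<open>Only finitely many factors are exceptional, so some factor is not. Being
      nontrivial, it has a deviation below \<open>\<alpha>\<close>, which the induction hypothesis
      refutes with \<open>g i\<close>.\<close>
    from ex_new_if_finite[OF infinite_UNIV_nat this[OF chain]] obtain i and \<beta> :: "'i rel" where "\<beta> <o \<alpha>"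
      "has_dev (interval_of A (f (X (Suc i))) (f (X i))) \<beta>"
      using nontriv by blast
    then show False using 1(1) g_in g_mono by blast
  qed
qed

text \<open>Cantor's theorem, since the field of \<open>\<beta>\<close> is no larger than its type.
  This gives one ordinal above all well-orders on a type, so deviations can be bounded without
  forming a supremum.\<close>

lemma ordLess_card_of_UNIV:
  fixes \<beta> :: "'i rel"
  assumes "Well_order \<beta>"
  shows "\<beta> <o |UNIV :: 'i set set|"
proof (rule ccontr)
  assume "\<not> \<beta> <o |UNIV :: 'i set set|"
  then have "|UNIV :: 'i set set| \<le>o \<beta>"
    using assms card_of_Well_order ordLess_or_ordLeq by blast
  then have "|UNIV :: 'i set set| \<le>o |Field \<beta>|"
    using card_of_mono2[of "|UNIV :: 'i set set|" \<beta>] by (simp add: Field_card_of)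
  also have "|Field \<beta>| \<le>o |UNIV :: 'i set|"
    by (rule card_of_mono1) simp
  finally have "|UNIV :: 'i set set| \<le>o |UNIV :: 'i set|"
    using ordLeq_transitive by blast
  then show False
    using card_of_Pow[of "UNIV :: 'i set"] not_ordLess_ordLeq by auto
qed

text \<open>The ascending chain condition permits induction on the lower end \<open>l\<close>, with
  the claim known for all larger lower ends in \<open>A\<close>. In a descending chain of the
  interval, at most one nontrivial factor has lower end \<open>l\<close>; the other nontrivial ones
  fall under the induction hypothesis.\<close>

lemma has_dev_ACC:
  fixes A :: "'p::order set"
  assumes acc: "\<And>a :: nat \<Rightarrow> 'p. \<forall>i. a i \<in> A \<Longrightarrow> \<forall>i. a i \<le> a (Suc i) \<Longrightarrow> \<exists>n. \<forall>i\<ge>n. a i = a n"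
    and l: "l \<in> A"
  shows "trivial_poset (interval_of A l u) \<or>
    (\<exists>\<alpha> :: ('p \<times> 'p) rel. has_dev (interval_of A l u) \<alpha>)"
proof -
  have "wf {(y, x). x \<in> A \<and> y \<in> A \<and> x < y}"
    unfolding wf_iff_no_infinite_down_chain
  proof
    assume "\<exists>f. \<forall>i. (f (Suc i), f i) \<in> {(y, x). x \<in> A \<and> y \<in> A \<and> x < y}"
    then obtain f where f: "\<And>i. f i \<in> A" "\<And>i. f i < f (Suc i)" by auto
    then obtain n where "\<forall>i\<ge>n. f i = f n" using acc[of f] by (meson order_less_imp_le)
    then show False using f(2)[of n] by (metis le_SucI less_irrefl order_refl)
  qed
  then show ?thesis using l
  proof (induction l arbitrary: u rule: wf_induct_rule)
    case (less l)
    \<comment> \<open>\<open>?\<alpha>\<close> exceeds every deviation supplied by the induction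
      hypothesis. It lives on a larger type; \<open>has_dev_all_types\<close> brings the result back
      at the end.\<close>
    let ?B = "interval_of A l u" and ?\<alpha> = "|UNIV :: ('p \<times> 'p) set set|"
    define below where "below C \<longleftrightarrow> trivial_poset C \<or>
      (\<exists>\<beta>\<in>{\<beta> :: ('p \<times> 'p) set rel. \<beta> <o ?\<alpha>}. has_dev C \<beta>)" for C :: "'p set"
    have below: "below (interval_of A x y)" if x: "x \<in> A" "l < x" for x y
    proof -
      have "trivial_poset (interval_of A x y) \<or>
          (\<exists>\<beta> :: ('p \<times> 'p) rel. has_dev (interval_of A x y) \<beta>)"
        using less.IH[of x y] less.prems x by blast
      moreover have "\<exists>\<beta>' :: ('p \<times> 'p) set rel. \<beta>' <o ?\<alpha> \<and> has_dev (interval_of A x y) \<beta>'"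
        if \<beta>: "has_dev (interval_of A x y) \<beta>" for \<beta> :: "('p \<times> 'p) rel"
      proof -
        have "\<beta> <o ?\<alpha>" by (rule ordLess_card_of_UNIV[OF has_dev_Well_order[OF \<beta>]])
        then obtain \<beta>' :: "('p \<times> 'p) set rel" where "\<beta>' <o ?\<alpha>" "\<beta> =o \<beta>'"
          using ordLess_transfer ordIso_reflexive card_of_Well_order by blast
        then show ?thesis using \<beta> has_dev_cong by blast
      qed
      ultimately show ?thesis unfolding below_def by blast
    qed
    have fin: "finite {i. \<not> below (interval_of ?B (a (Suc i)) (a i))}"
      if a: "descending_chain ?B a" for a
    proof -
      have aB: "a i \<in> ?B" and dec: "a (Suc i) \<le> a i" for i
        using a by (auto simp: descending_chain_def)
      have eq: "interval_of ?B (a (Suc i)) (a i) = interval_of A (a (Suc i)) (a i)" for i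
        by (rule interval_of_interval_of[OF aB aB])
      have anti: "a j \<le> a i" if "i \<le> j" for i j
        using lift_Suc_antimono_le[of a] dec that by blast
      have bad: "a (Suc i) = l \<and> a i \<noteq> l" if "\<not> below (interval_of ?B (a (Suc i)) (a i))" for i
      proof -
        have "a (Suc i) = l"
          using that below[of "a (Suc i)"] aB[of "Suc i"] unfolding eq
          by (auto simp: interval_of_def order.order_iff_strict)
        moreover have "a i \<noteq> a (Suc i)"
          using that unfolding below_def trivial_poset_def interval_of_def by force
        ultimately show ?thesis by simp
      qed
      \<comment> \<open>A chain that has reached \<open>l\<close> stays there, so it drops to
        \<open>l\<close> from a larger element only once.\<close>
      have "i = j" if "\<not> below (interval_of ?B (a (Suc i)) (a i))"
        "\<not> below (interval_of ?B (a (Suc j)) (a j))" for i j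
      proof (rule ccontr)
        have *: False if "Suc i \<le> j" "a (Suc i) = l" "a j \<noteq> l" for i j
          using anti[OF that(1)] aB[of j] that by (auto simp: interval_of_def)
        assume "i \<noteq> j"
        then show False using *[of i j] *[of j i] bad[OF that(1)] bad[OF that(2)] by linarith
      qed
      then have "{i. \<not> below (interval_of ?B (a (Suc i)) (a i))} \<subseteq>
          {THE i. \<not> below (interval_of ?B (a (Suc i)) (a i))}"
        by (auto intro!: the_equality[symmetric])
      then show ?thesis using finite_subset by blast
    qed
    \<comment> \<open>Either the deviation is smaller than \<open>?\<alpha>\<close>, or, as
      \<open>fin\<close> covers every chain, it equals \<open>?\<alpha>\<close>.\<close>
    have "\<exists>\<beta> :: ('p \<times> 'p) set rel. has_dev ?B \<beta>" if nt: "\<not> trivial_poset ?B"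
    proof (cases "below ?B")
      case True
      then show ?thesis using nt unfolding below_def by blast
    next
      case False
      have "?\<alpha> \<noteq> {}"
        by (metis Field_card_of Field_empty UNIV_not_empty)
      then have "has_dev ?B ?\<alpha>"
        using False fin card_of_Well_order
        unfolding has_dev.simps[of ?B ?\<alpha>] Let_def below_def by auto
      then show ?thesis by blast
    qed
    then show ?case using has_dev_all_types by blast
  qed
qed

section \<open>Quotients and submodules as modules\<close>

text \<open>The action is a union over all representatives, so none has to be chosen; for a
  submodule \<open>N\<close> and a ring element \<open>r\<close> the cosets in this union
  coincide.\<close>

definition quotient_rmodule ::
  "('a, 'b) rmodule \<Rightarrow> 'b set \<Rightarrow> ('a, 'b set) rmodule" where
  "quotient_rmodule M N =
    \<lparr>carrier = a_rcosets\<^bsub>M\<^esub> N, mult = undefined, one = undefined, zero = N, add = set_add M,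
     rsmult = (\<lambda>X r. \<Union>x\<in>X. N +>\<^bsub>M\<^esub> x \<cdot>\<^bsub>M\<^esub> r)\<rparr>"

context
  fixes R :: "('a, 'm) ring_scheme" and M :: "('a, 'b) rmodule" and N
  assumes M: "right_module R M" and N: "rsubmodule R M N"
begin

interpretation right_module R M by (fact M)

interpretation abelian_subgroup N M
  using N by (intro abelian_subgroupI3 additive_subgroup.intro M.abelian_group_axioms)
    (simp add: rsubmodule_def)

lemma quotient_rmodule_sel:
  "carrier (quotient_rmodule M N) = (\<lambda>x. N +>\<^bsub>M\<^esub> x) ` carrier M"
  "\<zero>\<^bsub>quotient_rmodule M N\<^esub> = N"
  by (auto simp: quotient_rmodule_def A_RCOSETS_def')

lemma quotient_rmodule_add:
  "x \<in> carrier M \<Longrightarrow> y \<in> carrier M \<Longrightarrow>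
    (N +>\<^bsub>M\<^esub> x) \<oplus>\<^bsub>quotient_rmodule M N\<^esub> (N +>\<^bsub>M\<^esub> y) = N +>\<^bsub>M\<^esub> (x \<oplus>\<^bsub>M\<^esub> y)"
  by (simp add: quotient_rmodule_def a_rcos_sum)

lemma quotient_rmodule_rsmult:
  assumes "x \<in> carrier M" "r \<in> carrier R"
  shows "(N +>\<^bsub>M\<^esub> x) \<cdot>\<^bsub>quotient_rmodule M N\<^esub> r = N +>\<^bsub>M\<^esub> x \<cdot>\<^bsub>M\<^esub> r"
proof -
  have eq: "N +>\<^bsub>M\<^esub> y \<cdot>\<^bsub>M\<^esub> r = N +>\<^bsub>M\<^esub> x \<cdot>\<^bsub>M\<^esub> r" if y: "y \<in> N +>\<^bsub>M\<^esub> x" for y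
  proof -
    obtain n where n: "n \<in> N" "y = n \<oplus>\<^bsub>M\<^esub> x" using y by (auto simp: a_r_coset_def')
    then have "y \<cdot>\<^bsub>M\<^esub> r = n \<cdot>\<^bsub>M\<^esub> r \<oplus>\<^bsub>M\<^esub> x \<cdot>\<^bsub>M\<^esub> r"
      using assms rsubmoduleD(1)[OF N] by (auto simp: rsmult_l_distr)
    then have "y \<cdot>\<^bsub>M\<^esub> r \<in> N +>\<^bsub>M\<^esub> x \<cdot>\<^bsub>M\<^esub> r"
      using n rsubmoduleD(4)[OF N _ assms(2)] by (auto simp: a_r_coset_def')
    then show ?thesis using a_repr_independence' assms by (metis rsmult_closed)
  qed
  have "x \<in> N +>\<^bsub>M\<^esub> x" using a_rcos_self assms by blast
  then have "(\<Union>y\<in>N +>\<^bsub>M\<^esub> x. N +>\<^bsub>M\<^esub> y \<cdot>\<^bsub>M\<^esub> r) = N +>\<^bsub>M\<^esub> x \<cdot>\<^bsub>M\<^esub> r"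
    using eq by (intro SUP_eq_const) blast+
  then show ?thesis by (simp add: quotient_rmodule_def)
qed

lemma right_module_quotient: "right_module R (quotient_rmodule M N)"
proof -
  let ?Q = "quotient_rmodule M N"
  note [simp] = quotient_rmodule_sel quotient_rmodule_add quotient_rmodule_rsmult
  have N0: "N +>\<^bsub>M\<^esub> \<zero>\<^bsub>M\<^esub> = N" using a_subset M.a_coset_add_zero by blast
  have "abelian_group ?Q"
  proof (rule abelian_groupI)
    show "\<zero>\<^bsub>?Q\<^esub> \<in> carrier ?Q" using N0 by (auto intro!: image_eqI[of _ _ "\<zero>\<^bsub>M\<^esub>"])
  next
    fix X assume "X \<in> carrier ?Q"
    then obtain x where x: "x \<in> carrier M" "X = N +>\<^bsub>M\<^esub> x" by auto
    show "\<zero>\<^bsub>?Q\<^esub> \<oplus>\<^bsub>?Q\<^esub> X = X"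
      using x quotient_rmodule_add[of "\<zero>\<^bsub>M\<^esub>" x] N0 by simp
    show "\<exists>Y\<in>carrier ?Q. Y \<oplus>\<^bsub>?Q\<^esub> X = \<zero>\<^bsub>?Q\<^esub>"
      using x N0 by (intro bexI[of _ "N +>\<^bsub>M\<^esub> (\<ominus>\<^bsub>M\<^esub> x)"]) (auto simp: M.l_neg)
  qed (auto simp: M.add.m_ac)
  then show ?thesis
    by (intro right_module.intro right_module_axioms.intro R.ring_axioms)
      (auto simp: rsmult_r_distr rsmult_l_distr rsmult_assoc)
qed

lemma quotient_rmodule_eq_zero:
  "x \<in> carrier M \<Longrightarrow> N +>\<^bsub>M\<^esub> x = N \<longleftrightarrow> x \<in> N"
  using a_rcos_self a_rcos_const by blast

end

lemma right_module_restrict: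
  assumes "right_module R M" "rsubmodule R M N"
  shows "right_module R (M\<lparr>carrier := N\<rparr>)"
proof -
  interpret right_module R M by fact
  note D = rsubmoduleD[OF assms(2)]
  have [simp]: "x \<in> carrier M" if "x \<in> N" for x using D(1) that by blast
  have "abelian_group (M\<lparr>carrier := N\<rparr>)"
  proof (rule abelian_groupI)
    fix x assume "x \<in> carrier (M\<lparr>carrier := N\<rparr>)"
    then show "\<exists>y\<in>carrier (M\<lparr>carrier := N\<rparr>). y \<oplus>\<^bsub>M\<lparr>carrier := N\<rparr>\<^esub> x = \<zero>\<^bsub>M\<lparr>carrier := N\<rparr>\<^esub>"
      using D(5) by (intro bexI[of _ "\<ominus>\<^bsub>M\<^esub> x"]) (auto simp: M.l_neg)
  qed (use D in \<open>auto simp: M.add.m_ac\<close>)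
  then show ?thesis
    by (intro right_module.intro right_module_axioms.intro R.ring_axioms)
      (use D in \<open>auto simp: rsmult_r_distr rsmult_l_distr rsmult_assoc\<close>)
qed

lemma rsubmodule_restrictD:
  assumes "right_module R M" "rsubmodule R M N" "rsubmodule R (M\<lparr>carrier := N\<rparr>) P"
  shows "rsubmodule R M P"
  by (rule rsubmoduleI[OF assms(1)])
    (use rsubmoduleD[OF assms(2)] rsubmoduleD[OF assms(3)] in auto)

lemma (in right_module) rsmult_zero:
  "x \<in> carrier M \<Longrightarrow> x \<cdot>\<^bsub>M\<^esub> \<zero>\<^bsub>R\<^esub> = \<zero>\<^bsub>M\<^esub>"
  using rsmult_r_distr[of x "\<zero>\<^bsub>R\<^esub>" "\<zero>\<^bsub>R\<^esub>"] by simp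

lemma (in right_module) zero_rsmult:
  "r \<in> carrier R \<Longrightarrow> \<zero>\<^bsub>M\<^esub> \<cdot>\<^bsub>M\<^esub> r = \<zero>\<^bsub>M\<^esub>"
  using rsmult_l_distr[of "\<zero>\<^bsub>M\<^esub>" "\<zero>\<^bsub>M\<^esub>" r] by simp

lemma (in right_module) rsubmodule_cyclic:
  assumes "x \<in> carrier M"
  shows "rsubmodule R M ((\<lambda>r. x \<cdot>\<^bsub>M\<^esub> r) ` carrier R)"
proof (rule rsubmoduleI[OF right_module_axioms])
  show "\<zero>\<^bsub>M\<^esub> \<in> (\<lambda>r. x \<cdot>\<^bsub>M\<^esub> r) ` carrier R"
    using rsmult_zero[OF assms] by (metis R.zero_closed image_eqI)
qed (use assms in \<open>auto simp: rsmult_r_distr[symmetric] rsmult_assoc[symmetric]\<close>)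

lemma regular_rmodule_sel [simp]:
  "carrier (regular_rmodule R) = carrier R" "\<zero>\<^bsub>regular_rmodule R\<^esub> = \<zero>\<^bsub>R\<^esub>"
  "x \<oplus>\<^bsub>regular_rmodule R\<^esub> y = x \<oplus>\<^bsub>R\<^esub> y" "x \<cdot>\<^bsub>regular_rmodule R\<^esub> y = x \<otimes>\<^bsub>R\<^esub> y"
  by (simp_all add: regular_rmodule_def)


section \<open>Separation by maximal right ideals\<close>

text \<open>Zorn's lemma: the union of a nonempty chain of submodules avoiding \<open>a\<close>
  avoids \<open>a\<close>. The last property will make the image of \<open>a\<close> generate a
  simple submodule modulo \<open>K\<close>.\<close>

lemma rsubmodule_maximal_avoiding:
  assumes M: "right_module R M" and I: "rsubmodule R M I" and a: "a \<notin> I"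
  obtains K where "rsubmodule R M K" "I \<subseteq> K" "a \<notin> K"
    "\<And>P. rsubmodule R M P \<Longrightarrow> K \<subset> P \<Longrightarrow> a \<in> P"
proof -
  let ?A = "{K. rsubmodule R M K \<and> I \<subseteq> K \<and> a \<notin> K}"
  have "\<Union>C \<in> ?A" if C: "C \<noteq> {}" "subset.chain ?A C" for C
  proof -
    have sub: "rsubmodule R M P \<and> I \<subseteq> P \<and> a \<notin> P" if "P \<in> C" for P
      using C(2) that by (auto simp: subset.chain_def)
    have "rsubmodule R M (\<Union>C)"
    proof (rule rsubmoduleI[OF M])
      show "\<Union>C \<subseteq> carrier M" using sub rsubmoduleD(1) by blast
      show "\<zero>\<^bsub>M\<^esub> \<in> \<Union>C" using sub C(1) rsubmoduleD(2) by blast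
      show "x \<cdot>\<^bsub>M\<^esub> r \<in> \<Union>C" if "x \<in> \<Union>C" "r \<in> carrier R" for x r
        using sub that rsubmoduleD(4) by (metis Union_iff)
      show "x \<oplus>\<^bsub>M\<^esub> y \<in> \<Union>C" if xy: "x \<in> \<Union>C" "y \<in> \<Union>C" for x y
      proof -
        obtain P P' where P: "x \<in> P" "P \<in> C" "y \<in> P'" "P' \<in> C" using xy by blast
        then have "P \<subseteq> P' \<or> P' \<subseteq> P"
          using C(2) by (auto simp: subset.chain_def)
        then obtain P'' where "x \<in> P''" "y \<in> P''" "P'' \<in> C" using P by blast
        then show ?thesis using sub rsubmoduleD(3) by (metis Union_iff)
      qed
    qed
    then show ?thesis using sub C(1) by blast
  qed
  moreover have "?A \<noteq> {}" using I a by blast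
  ultimately obtain K where "K \<in> ?A" "\<And>P. P \<in> ?A \<Longrightarrow> K \<subseteq> P \<Longrightarrow> P = K"
    using subset_Zorn_nonempty[of ?A] by meson
  then show ?thesis by (intro that) blast+
qed

text \<open>\<open>K\<close> already separates \<open>a\<close> from \<open>I\<close>, but
  \<open>R / K\<close> need not be simple. Purity replaces \<open>1 + K\<close> by an element
  \<open>s\<close> of the simple submodule with the same products by \<open>a\<close> and all
  \<open>b i\<close>, and the annihilator of \<open>s\<close> still separates.\<close>

lemma right_SAP_separation:
  fixes R :: "('a, 'm) ring_scheme" and n :: nat
  assumes sap: "right_SAP R" and I: "rsubmodule R (regular_rmodule R) I"
    and b: "\<And>i. i < n \<Longrightarrow> b i \<in> I" and a: "a \<in> carrier R" "a \<notin> I"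
  \<comment> \<open>the last condition says that \<open>R / L\<close> is simple\<close>
  obtains L where "rsubmodule R (regular_rmodule R) L" "\<And>i. i < n \<Longrightarrow> b i \<in> L" "a \<notin> L"
    "\<And>x r. x \<in> carrier R \<Longrightarrow> x \<notin> L \<Longrightarrow> r \<in> carrier R \<Longrightarrow> \<exists>t\<in>carrier R. r \<ominus>\<^bsub>R\<^esub> x \<otimes>\<^bsub>R\<^esub> t \<in> L"
proof -
  have ring: "ring R" using sap by (simp add: right_SAP_def)
  let ?M = "regular_rmodule R"
  have M: "right_module R ?M" by (rule right_module_regular[OF ring])
  interpret right_module R ?M by (fact M)
  obtain K where K: "rsubmodule R ?M K" and IK: "I \<subseteq> K" and aK: "a \<notin> K"
    and maxK: "\<And>P. rsubmodule R ?M P \<Longrightarrow> K \<subset> P \<Longrightarrow> a \<in> P"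
    using rsubmodule_maximal_avoiding[OF M I a(2)] by blast
  define Q where "Q = quotient_rmodule ?M K"
  define q where "q x = K +>\<^bsub>?M\<^esub> x" for x
  have Q: "right_module R Q" unfolding Q_def by (rule right_module_quotient[OF M K])
  interpret Q: right_module R Q by (fact Q)
  have cQ: "carrier Q = q ` carrier R" and Q0: "\<zero>\<^bsub>Q\<^esub> = K"
    using quotient_rmodule_sel[OF M K] by (auto simp: Q_def q_def)
  have qadd: "q x \<oplus>\<^bsub>Q\<^esub> q y = q (x \<oplus>\<^bsub>R\<^esub> y)" if "x \<in> carrier R" "y \<in> carrier R" for x y
    using quotient_rmodule_add[OF M K, of x y] that by (simp add: Q_def q_def)
  have qmult: "q x \<cdot>\<^bsub>Q\<^esub> r = q (x \<otimes>\<^bsub>R\<^esub> r)" if "x \<in> carrier R" "r \<in> carrier R" for x r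
    using quotient_rmodule_rsmult[OF M K, of x r] that by (simp add: Q_def q_def)
  have q0: "q x = K \<longleftrightarrow> x \<in> K" if "x \<in> carrier R" for x
    using quotient_rmodule_eq_zero[OF M K, of x] that by (simp add: q_def)
  have qc: "q x \<in> carrier Q" if "x \<in> carrier R" for x using that cQ by blast
  define C where "C = (\<lambda>r. q a \<cdot>\<^bsub>Q\<^esub> r) ` carrier R"
  have C: "rsubmodule R Q C" unfolding C_def by (rule Q.rsubmodule_cyclic[OF qc[OF a(1)]])
  have aC: "q a \<in> C"
    using Q.rsmult_one[OF qc[OF a(1)]] unfolding C_def by (metis R.one_closed image_eqI)
  let ?S = "Q\<lparr>carrier := C\<rparr>"
  \<comment> \<open>The preimage of \<open>P\<close> in \<open>R\<close> contains \<open>K\<close>;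
    if it is larger, it contains \<open>a\<close> by the choice of \<open>K\<close>. Stated inside
    \<open>Q\<close>, the fact also serves later for the submodule generated by a multiple of
    \<open>s\<close>.\<close>
  have simple: "P = {K} \<or> P = C" if P: "rsubmodule R Q P" "P \<subseteq> C" for P
  proof -
    note D = rsubmoduleD[OF P(1)]
    let ?P = "{r \<in> carrier R. q r \<in> P}"
    have qP: "q \<zero>\<^bsub>R\<^esub> \<in> P"
      using D(2) Q0 q0[of "\<zero>\<^bsub>R\<^esub>"] rsubmoduleD(2)[OF K] by simp
    have sub: "rsubmodule R ?M ?P"
      using D qP by (intro rsubmoduleI[OF M]) (auto simp: qadd[symmetric] qmult[symmetric])
    have KP: "K \<subseteq> ?P" using D(2)[unfolded Q0] q0 rsubmoduleD(1)[OF K] by auto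
    show ?thesis
    proof (cases "?P = K")
      case True
      have "P \<subseteq> {K}" using D(1) True q0 cQ by auto
      then show ?thesis using D(2) Q0 by blast
    next
      case False
      then have "q a \<in> P" using maxK[OF sub] KP by blast
      then have "C \<subseteq> P" using D(4) unfolding C_def by blast
      then show ?thesis using P(2) by blast
    qed
  qed
  have S: "simple_rmodule R ?S"
    unfolding simple_rmodule_def
  proof (intro conjI allI impI)
    show "right_module R ?S" by (rule right_module_restrict[OF Q C])
    show "carrier ?S \<noteq> {\<zero>\<^bsub>?S\<^esub>}" using aC aK q0[OF a(1)] Q0 by auto
    fix P assume P: "rsubmodule R ?S P"
    then show "P = {\<zero>\<^bsub>?S\<^esub>} \<or> P = carrier ?S"
      using simple[OF rsubmodule_restrictD[OF Q C P]] rsubmoduleD(1)[OF P] Q0 by auto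
  qed
  have "(\<lambda>x. x) \<in> rmodule_hom R ?S Q" using rsubmoduleD(1)[OF C] by (auto simp: rmodule_hom_def)
  then have pure: "pure_rsubmodule R Q C"
    using absolutely_pure_all_types[of R ?S Q "\<lambda>x. x"] sap S Q by (auto simp: right_SAP_def)
  \<comment> \<open>One unknown and \<open>Suc n\<close> equations: the first \<open>n\<close> say
    that \<open>b i\<close> annihilates it (\<open>K\<close> is the zero of \<open>Q\<close>), and
    the last, at index \<open>n\<close>, fixes its product with \<open>a\<close>.\<close>
  let ?A = "\<lambda>i (j::nat). if i < n then b i else a" and ?p = "\<lambda>i. if i < n then K else q a"
  have bR: "b i \<in> carrier R" if "i < n" for i using b[OF that] rsubmoduleD(1)[OF I] by auto
  have sum1: "(\<Oplus>\<^bsub>Q\<^esub>j\<in>{..<1::nat}. t j) = t 0" if "t 0 \<in> carrier Q" for t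
    using that by (simp add: lessThan_Suc)
  have A: "\<forall>i<Suc n. \<forall>j<1. ?A i j \<in> carrier R" using bR a(1) by auto
  have one: "solves Q (Suc n) 1 ?A ?p (\<lambda>_. q \<one>\<^bsub>R\<^esub>)"
    unfolding solves_def
  proof (intro allI impI)
    fix i assume "i < Suc n"
    have "q \<one>\<^bsub>R\<^esub> \<cdot>\<^bsub>Q\<^esub> ?A i 0 = ?p i"
      using bR a(1) qmult[of "\<one>\<^bsub>R\<^esub>"] q0[OF bR] b IK by auto
    moreover have "?p i \<in> carrier Q" using Q0 Q.M.zero_closed qc[OF a(1)] by auto
    ultimately show "(\<Oplus>\<^bsub>Q\<^esub>j\<in>{..<1}. q \<one>\<^bsub>R\<^esub> \<cdot>\<^bsub>Q\<^esub> ?A i j) = ?p i"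
      using sum1[of "\<lambda>j. q \<one>\<^bsub>R\<^esub> \<cdot>\<^bsub>Q\<^esub> ?A i j"] by simp
  qed
  have "\<forall>i<Suc n. ?p i \<in> C" using aC rsubmoduleD(2)[OF C] Q0 by auto
  then have "\<exists>y. (\<forall>j<1. y j \<in> C) \<and> solves Q (Suc n) 1 ?A ?p y"
    using A one qc[OF R.one_closed]
    by (intro pure[unfolded pure_rsubmodule_def, THEN conjunct2, THEN spec, THEN spec,
          THEN spec, THEN spec, THEN mp] conjI exI[of _ "\<lambda>_. q \<one>\<^bsub>R\<^esub>"]) auto
  then obtain y where "\<forall>j<1. y j \<in> C" and sol: "solves Q (Suc n) 1 ?A ?p y"
    by blast
  then have sC: "y 0 \<in> C" by simp
  define s where "s = y 0"
  have s: "s \<in> C" "s \<in> carrier Q" using sC rsubmoduleD(1)[OF C] by (auto simp: s_def)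
  have eqs: "s \<cdot>\<^bsub>Q\<^esub> ?A i 0 = ?p i" if "i < Suc n" for i
  proof -
    have "s \<cdot>\<^bsub>Q\<^esub> ?A i 0 \<in> carrier Q" using s A that by auto
    then show ?thesis
      using sol that sum1[of "\<lambda>j. y j \<cdot>\<^bsub>Q\<^esub> ?A i j"] unfolding solves_def s_def by auto
  qed
  define L where "L = {r \<in> carrier R. s \<cdot>\<^bsub>Q\<^esub> r = \<zero>\<^bsub>Q\<^esub>}"
  show ?thesis
  proof (rule that[of L])
    show "rsubmodule R ?M L"
      using s by (intro rsubmoduleI[OF M])
        (auto simp: L_def Q.rsmult_zero Q.rsmult_r_distr Q.rsmult_assoc Q.zero_rsmult)
    show "b i \<in> L" if "i < n" for i using eqs[of i] that bR Q0 by (simp add: L_def)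
    show "a \<notin> L" using eqs[of n] aK q0[OF a(1)] Q0 by (simp add: L_def)
  next
    fix x r assume x: "x \<in> carrier R" "x \<notin> L" and r: "r \<in> carrier R"
    \<comment> \<open>Since \<open>x\<close> is outside the annihilator, the nonzero element
      \<open>s x\<close> generates all of \<open>C\<close>. Hence \<open>s r = s x t\<close> for
      some \<open>t\<close>, and \<open>r - x t\<close> annihilates \<open>s\<close>.\<close>
    let ?X = "(\<lambda>t. (s \<cdot>\<^bsub>Q\<^esub> x) \<cdot>\<^bsub>Q\<^esub> t) ` carrier R"
    have sx: "s \<cdot>\<^bsub>Q\<^esub> x \<in> C" "s \<cdot>\<^bsub>Q\<^esub> x \<in> carrier Q"
      using s x rsubmoduleD(4)[OF C] by auto
    have "?X \<subseteq> C" using sx rsubmoduleD(4)[OF C] by blast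
    moreover have "s \<cdot>\<^bsub>Q\<^esub> x \<in> ?X"
      using Q.rsmult_one[OF sx(2)] by (metis R.one_closed image_eqI)
    moreover have "s \<cdot>\<^bsub>Q\<^esub> x \<noteq> K" using x Q0 by (auto simp: L_def)
    ultimately have "?X = C" using simple[OF Q.rsubmodule_cyclic[OF sx(2)]] by blast
    moreover have "s \<cdot>\<^bsub>Q\<^esub> r \<in> C" using s r rsubmoduleD(4)[OF C] by blast
    ultimately obtain t where t: "t \<in> carrier R" "s \<cdot>\<^bsub>Q\<^esub> r = (s \<cdot>\<^bsub>Q\<^esub> x) \<cdot>\<^bsub>Q\<^esub> t"
      by (metis imageE)
    have "s \<cdot>\<^bsub>Q\<^esub> (r \<ominus>\<^bsub>R\<^esub> x \<otimes>\<^bsub>R\<^esub> t) \<oplus>\<^bsub>Q\<^esub> s \<cdot>\<^bsub>Q\<^esub> (x \<otimes>\<^bsub>R\<^esub> t) = s \<cdot>\<^bsub>Q\<^esub> r"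
      using s x r t(1) by (simp add: Q.rsmult_r_distr[symmetric] R.minus_eq R.a_assoc R.l_neg)
    moreover have "s \<cdot>\<^bsub>Q\<^esub> (x \<otimes>\<^bsub>R\<^esub> t) = s \<cdot>\<^bsub>Q\<^esub> r"
      using s x t by (simp add: Q.rsmult_assoc)
    ultimately have "s \<cdot>\<^bsub>Q\<^esub> (r \<ominus>\<^bsub>R\<^esub> x \<otimes>\<^bsub>R\<^esub> t) = \<zero>\<^bsub>Q\<^esub>"
      using s x r t(1) by (simp add: Q.M.add.r_cancel_one)
    then show "\<exists>t\<in>carrier R. r \<ominus>\<^bsub>R\<^esub> x \<otimes>\<^bsub>R\<^esub> t \<in> L"
      using x r t(1) by (auto simp: L_def)
  qed
qed

text \<open>If for each \<open>m\<close> some element misses \<open>L m\<close> but lies in every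
  other \<open>L n\<close>, then distinct sets of indices give distinct intersections of the
  \<open>L n\<close>.\<close>

lemma strict_mono_Pow_right_ideals:
  fixes R :: "('a, 'm) ring_scheme"
  assumes sap: "right_SAP R" and "\<not> right_noetherian R"
  obtains f :: "nat set \<Rightarrow> 'a set"
  where "\<And>X. rsubmodule R (regular_rmodule R) (f X)" "strict_mono f"
proof -
  have ring: "ring R" using sap by (simp add: right_SAP_def)
  let ?M = "regular_rmodule R"
  have M: "right_module R ?M" by (rule right_module_regular[OF ring])
  interpret right_module R ?M by (fact M)
  obtain I :: "nat \<Rightarrow> 'a set" where I: "\<And>i. rsubmodule R ?M (I i)" "\<And>i. I i \<subseteq> I (Suc i)"
    and "\<nexists>n. \<forall>i\<ge>n. I i = I n"
    using assms(2) unfolding right_noetherian_def by auto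
  then have nonstat: "\<exists>i\<ge>n. I i \<noteq> I n" for n by blast
  have I_mono: "I i \<subseteq> I j" if "i \<le> j" for i j
    using lift_Suc_mono_le[of I] I(2) that by blast
  \<comment> \<open>The chain may pause before it grows again, so \<open>nx\<close> jumps to an
    index where something new has appeared; iterating it gives the strict subchain
    \<open>I (k n)\<close>.\<close>
  have "\<exists>j a. i \<le> j \<and> a \<in> I j - I i" for i using nonstat[of i] I_mono by blast
  then obtain nx pick where nx: "\<And>i. i \<le> nx i" "\<And>i. pick i \<in> I (nx i) - I i" by metis
  define k where "k n = (nx ^^ n) 0" for n
  define a where "a n = pick (k n)" for n
  have k_mono: "k m \<le> k n" if "m \<le> n" for m n
    using lift_Suc_mono_le[of k] nx(1) that by (simp add: k_def)
  have a: "a n \<in> I (k (Suc n))" "a n \<notin> I (k n)" for n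
    using nx(2)[of "k n"] by (auto simp: a_def k_def)
  have aR: "a n \<in> carrier R" for n using a(1) rsubmoduleD(1)[OF I(1)] by auto
  have "a i \<in> I (k n)" if "i < n" for i n
    using a(1)[of i] I_mono[OF k_mono[of "Suc i" n]] that by auto
  then have "\<exists>L. rsubmodule R ?M L \<and> (\<forall>i<n. a i \<in> L) \<and> a n \<notin> L \<and>
      (\<forall>x r. x \<in> carrier R \<longrightarrow> x \<notin> L \<longrightarrow> r \<in> carrier R \<longrightarrow> (\<exists>t\<in>carrier R. r \<ominus>\<^bsub>R\<^esub> x \<otimes>\<^bsub>R\<^esub> t \<in> L))" for n
    using right_SAP_separation[OF sap I(1)[of "k n"], of n a "a n"] aR a(2) by (metis (no_types, lifting))
  then obtain L where L: "\<And>n. rsubmodule R ?M (L n)" "\<And>i n. i < n \<Longrightarrow> a i \<in> L n" "\<And>n. a n \<notin> L n"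
    "\<And>n x r. x \<in> carrier R \<Longrightarrow> x \<notin> L n \<Longrightarrow> r \<in> carrier R \<Longrightarrow> \<exists>t\<in>carrier R. r \<ominus>\<^bsub>R\<^esub> x \<otimes>\<^bsub>R\<^esub> t \<in> L n"
    by metis
  note D = rsubmoduleD[OF L(1), simplified]
  have minus: "x \<ominus>\<^bsub>R\<^esub> y \<in> L n" if "x \<in> L n" "y \<in> L n" for x y n
  proof -
    have xy: "x \<in> carrier R" "y \<in> carrier R" using that D(1) by auto
    have "x \<ominus>\<^bsub>R\<^esub> y = x \<oplus>\<^bsub>R\<^esub> y \<otimes>\<^bsub>R\<^esub> (\<ominus>\<^bsub>R\<^esub> \<one>\<^bsub>R\<^esub>)"
      using xy by (simp add: R.minus_eq R.r_minus)
    then show ?thesis using that D(3,4) by simp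
  qed
  have e: "\<exists>e\<in>carrier R. e \<notin> L m \<and> (\<forall>n. n \<noteq> m \<longrightarrow> e \<in> L n)" for m
  proof -
    \<comment> \<open>Downward induction from \<open>m\<close>, starting with \<open>a m\<close>,
      which lies in all \<open>L n\<close> with \<open>n > m\<close>. To reach \<open>L j\<close>, a
      multiple of \<open>a j\<close> is subtracted; it lies in every later \<open>L n\<close>, so
      neither the memberships already won nor the failure at \<open>m\<close> are disturbed.\<close>
    have "\<exists>e\<in>carrier R. e \<notin> L m \<and> (\<forall>n\<ge>j. n \<noteq> m \<longrightarrow> e \<in> L n)" if "j \<le> m" for j
      using that
    proof (induction rule: inc_induct)
      case base
      show ?case using aR[of m] L(2,3) by (metis le_neq_implies_less)
    next
      case (step j)
      then obtain e where e: "e \<in> carrier R" "e \<notin> L m" "\<And>n. Suc j \<le> n \<Longrightarrow> n \<noteq> m \<Longrightarrow> e \<in> L n" by blast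
      \<comment> \<open>As \<open>a j\<close> is outside \<open>L j\<close> and
        \<open>R / L j\<close> is simple, \<open>e\<close> is congruent to a multiple of
        \<open>a j\<close> modulo \<open>L j\<close>.\<close>
      obtain t where t: "t \<in> carrier R" "e \<ominus>\<^bsub>R\<^esub> a j \<otimes>\<^bsub>R\<^esub> t \<in> L j"
        using L(4)[OF aR L(3) e(1)] by blast
      have at: "a j \<otimes>\<^bsub>R\<^esub> t \<in> L n" if "j < n" for n using D(4)[OF L(2)[OF that] t(1)] .
      have "e \<ominus>\<^bsub>R\<^esub> a j \<otimes>\<^bsub>R\<^esub> t \<notin> L m"
      proof
        assume "e \<ominus>\<^bsub>R\<^esub> a j \<otimes>\<^bsub>R\<^esub> t \<in> L m"
        then have "e \<ominus>\<^bsub>R\<^esub> a j \<otimes>\<^bsub>R\<^esub> t \<oplus>\<^bsub>R\<^esub> a j \<otimes>\<^bsub>R\<^esub> t \<in> L m"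
          using at[of m] D(3) step.hyps by blast
        then show False using e(1,2) t(1) aR by (simp add: R.minus_eq R.a_assoc R.l_neg)
      qed
      moreover have "e \<ominus>\<^bsub>R\<^esub> a j \<otimes>\<^bsub>R\<^esub> t \<in> L n" if "j \<le> n" "n \<noteq> m" for n
        using that t(2) minus[OF e(3) at] by (cases "n = j") auto
      ultimately show ?case using e(1) t(1) aR by (metis R.minus_closed R.m_closed)
    qed
    from this[of 0] show ?thesis by auto
  qed
  \<comment> \<open>Intersecting over the complement of \<open>X\<close> makes \<open>f\<close>
    increasing. The carrier is included because for \<open>X = UNIV\<close> there is nothing to
    intersect.\<close>
  define f where "f X = {x \<in> carrier R. \<forall>n. n \<notin> X \<longrightarrow> x \<in> L n}" for X
  show ?thesis
  proof (rule that[of f])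
    show "rsubmodule R ?M (f X)" for X
      by (rule rsubmoduleI[OF M]) (use D in \<open>auto simp: f_def\<close>)
    show "strict_mono f"
    proof (rule strict_monoI)
      fix X Y :: "nat set" assume XY: "X < Y"
      then obtain m where m: "m \<in> Y" "m \<notin> X" by blast
      obtain e where e: "e \<in> carrier R" "e \<notin> L m" "\<And>n. n \<noteq> m \<Longrightarrow> e \<in> L n"
        using e[of m] by blast
      have "e \<in> L n" if "n \<notin> Y" for n using m(1) that by (intro e(3)) auto
      then have "e \<in> f Y" using e(1) by (simp add: f_def)
      moreover have "e \<notin> f X" using m e by (auto simp: f_def)
      moreover have "f X \<subseteq> f Y" using XY by (auto simp: f_def)
      ultimately show "f X < f Y" by blast
    qed
  qed
qed

theorem proposition3p5:
  fixes R :: "('a, 'm) ring_scheme"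
  assumes "ring R" and "right_SAP R"
  shows "right_noetherian R \<longleftrightarrow> has_right_krull_dim R"
proof
  let ?M = "regular_rmodule R"
  have M: "right_module R ?M" by (rule right_module_regular[OF assms(1)])
  assume noeth: "right_noetherian R"
  have zero: "rsubmodule R ?M {\<zero>\<^bsub>R\<^esub>}"
  proof -
    interpret right_module R ?M by (fact M)
    show ?thesis by (rule rsubmoduleI[OF M]) auto
  qed
  \<comment> \<open>The whole lattice is the interval from zero to the ring, the form required by
    \<open>has_dev_ACC\<close>.\<close>
  have eq: "interval_of (rsubmodules R ?M) {\<zero>\<^bsub>R\<^esub>} (carrier R) = rsubmodules R ?M"
    using rsubmoduleD(1,2)[of R ?M] by (auto simp: interval_of_def rsubmodules_def)
  have "\<exists>n. \<forall>i\<ge>n. I i = I n" if "\<forall>i. I i \<in> rsubmodules R ?M" "\<forall>i. I i \<subseteq> I (Suc i)" for I :: "nat \<Rightarrow> 'a set"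
    using noeth that unfolding right_noetherian_def rsubmodules_def by auto
  from has_dev_ACC[of "rsubmodules R ?M", OF this, of "{\<zero>\<^bsub>R\<^esub>}" "carrier R"]
  show "has_right_krull_dim R"
    using zero unfolding eq has_right_krull_dim_def has_krull_dim_def by (auto simp: rsubmodules_def)
next
  assume kd: "has_right_krull_dim R"
  show "right_noetherian R"
  proof (rule ccontr)
    assume "\<not> right_noetherian R"
    from strict_mono_Pow_right_ideals[OF assms(2) this] obtain f :: "nat set \<Rightarrow> 'a set"
      where "\<And>X. rsubmodule R (regular_rmodule R) (f X)" and mono: "strict_mono f"
      by blast
    then have f: "f X \<in> rsubmodules R (regular_rmodule R)" for X by (simp add: rsubmodules_def)
    \<comment> \<open>This excludes the value minus infinity, so that an ordinal deviation would
      have to exist.\<close>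
    have "f {} < f UNIV" using mono by (rule strict_monoD) auto
    then have "\<not> trivial_poset (rsubmodules R (regular_rmodule R))"
      using f[of "{}"] f[of UNIV] unfolding trivial_poset_def by (metis less_le)
    then show False
      using kd has_dev_no_strict_mono_Pow[OF _ f mono]
      unfolding has_right_krull_dim_def has_krull_dim_def by blast
  qed
qed

end
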